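(* Let $F\subset\mathrm{Sym}^2(\mathbb{R}^n)$ be a cone subequation such that $-P_e\notin F$ for every unit vector $e$. Let $\Omega\subset\mathbb{R}^n$ be a bounded domain with smooth strictly $F$-convex boundary, let $x_1,\dots,x_k\in\Omega$ be distinct, and let $r_0>0$ be such that the closed balls $\overline B_{r_0}(x_j)$ are mutually disjoint and contained in $\Omega$; for $0<r\le r_0$ set $D_r=\bigcup_j\overline B_r(x_j)$ and $\Omega_r=\Omega\setminus D_r$. Let $\varphi\in C(\partial\Omega)$ and let $\psi$ be an $F$-subharmonic function on $\Omega$ with $\psi|_{\partial\Omega}\le\varphi$ and such that either (polar case) $\psi:\overline\Omega\to[-\infty,\infty)$ is continuous and equals $-\infty$ exactly at $x_1,\dots,x_k$, or (finite case) $\psi\in C(\overline\Omega)$ and each $x_j$ is a strict local minimum point of $\psi$ at which $\psi$ has no test functions. Let $H_r(x)=\sup_{u\in\mathcal F_r}u(x)$, where $\mathcal F_r$ is the family of all $u\in\mathrm{USC}(\overline{\Omega_r})$ which are $F$-subharmonic on $\Omega_r$ with $u\le\psi$ on $\partial D_r$ and $u\le\varphi$ on $\partial\Omega$. Then $H_r\in C(\overline{\Omega_r})$, $H_r$ is $F$-harmonic on $\Omega_r$, $H_r|_{\partial D_r}=\psi|_{\partial D_r}$ and $H_r|_{\partial\Omega}=\varphi$.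
   Context: A cone subequation is a closed $F\subset\mathrm{Sym}^2(\mathbb{R}^n)$ with $A\in F,P\ge0\Rightarrow A+P\in F$ and $tF=F$ for $t>0$; $\tilde F=\{A:-A\notin\mathrm{Int}F\}$; $P_e$ is orthogonal projection onto $\mathbb{R}e$. $F$-subharmonic: upper semicontinuous $[-\infty,\infty)$-valued $u$ with $D^2\phi(y)\in F$ for every $C^2$ test function $\phi$ at $y$ ($u\le\phi$ near $y$, equality at $y$); $F$-harmonic: finite, continuous, $F$-subharmonic with $-u$ $\tilde F$-subharmonic. Smooth boundary strictly $F$-convex: for each $x\in\partial\Omega$ and local defining function $\rho$ ($\Omega=\{\rho<0\}$, $\nabla\rho\ne0$), $D^2\rho(x)+tP_\nu\in\mathrm{Int}F$ for all large $t$, $\nu$ the unit normal. *)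

theory Defs
  imports "HOL-Analysis.Analysis"
begin

definition sym_mats :: "(real^'n^'n) set" where
  "sym_mats = {A. transpose A = A}"

definition psd :: "real^'n^'n \<Rightarrow> bool" where
  "psd A \<longleftrightarrow> A \<in> sym_mats \<and> (\<forall>x. x \<bullet> (A *v x) \<ge> 0)"

definition cone_subequation :: "(real^'n^'n) set \<Rightarrow> bool" where
  "cone_subequation F \<longleftrightarrow> F \<subseteq> sym_mats \<and> closed F \<and>
     (\<forall>A\<in>F. \<forall>P. psd P \<longrightarrow> A + P \<in> F) \<and>
     (\<forall>t::real. t > 0 \<longrightarrow> (\<lambda>A. t *\<^sub>R A) ` F = F)"

definition sym_interior :: "(real^'n^'n) set \<Rightarrow> (real^'n^'n) set" where
  "sym_interior F = {A \<in> sym_mats. \<exists>e>0. \<forall>B\<in>sym_mats. dist B A < e \<longrightarrow> B \<in> F}"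

definition dual_subeq :: "(real^'n^'n) set \<Rightarrow> (real^'n^'n) set" where
  "dual_subeq F = {A \<in> sym_mats. - A \<notin> sym_interior F}"

text \<open>Orthogonal projection onto the line R e (e a unit vector).\<close>
definition proj_line :: "real^'n \<Rightarrow> real^'n^'n" where
  "proj_line e = (\<chi> i j. e $ i * e $ j)"

definition pd :: "'n \<Rightarrow> (real^'n \<Rightarrow> real) \<Rightarrow> real^'n \<Rightarrow> real" where
  "pd i f x = frechet_derivative f (at x) (axis i 1)"

definition grad :: "(real^'n \<Rightarrow> real) \<Rightarrow> real^'n \<Rightarrow> real^'n" where
  "grad f x = (\<chi> i. pd i f x)"

definition hess :: "(real^'n \<Rightarrow> real) \<Rightarrow> real^'n \<Rightarrow> real^'n^'n" where
  "hess f x = (\<chi> i j. pd i (pd j f) x)"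

fun Ck_on :: "nat \<Rightarrow> (real^'n) set \<Rightarrow> (real^'n \<Rightarrow> real) \<Rightarrow> bool" where
  "Ck_on 0 S f \<longleftrightarrow> continuous_on S f"
| "Ck_on (Suc k) S f \<longleftrightarrow> continuous_on S f \<and> (\<forall>x\<in>S. f differentiable (at x)) \<and>
      (\<forall>i. Ck_on k S (pd i f))"

definition smooth_on :: "(real^'n) set \<Rightarrow> (real^'n \<Rightarrow> real) \<Rightarrow> bool" where
  "smooth_on S f \<longleftrightarrow> (\<forall>k. Ck_on k S f)"

definition usc_on :: "(real^'n) set \<Rightarrow> (real^'n \<Rightarrow> ereal) \<Rightarrow> bool" where
  "usc_on S u \<longleftrightarrow> (\<forall>x\<in>S. \<forall>c. u x < c \<longrightarrow>
      (\<exists>e>0. \<forall>y\<in>S. dist y x < e \<longrightarrow> u y < c))"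

definition test_function :: "(real^'n \<Rightarrow> ereal) \<Rightarrow> real^'n \<Rightarrow> (real^'n) set \<Rightarrow> (real^'n \<Rightarrow> real) \<Rightarrow> bool" where
  "test_function u y S \<phi> \<longleftrightarrow> open S \<and> y \<in> S \<and> Ck_on 2 S \<phi> \<and>
      (\<forall>z\<in>S. u z \<le> ereal (\<phi> z)) \<and> u y = ereal (\<phi> y)"

definition subharmonic :: "(real^'n^'n) set \<Rightarrow> (real^'n) set \<Rightarrow> (real^'n \<Rightarrow> ereal) \<Rightarrow> bool" where
  "subharmonic F U u \<longleftrightarrow> usc_on U u \<and> (\<forall>x\<in>U. u x \<noteq> \<infinity>) \<and>
     (\<forall>y\<in>U. \<forall>S \<phi>. S \<subseteq> U \<and> test_function u y S \<phi> \<longrightarrow> hess \<phi> y \<in> F)"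

definition harmonic :: "(real^'n^'n) set \<Rightarrow> (real^'n) set \<Rightarrow> (real^'n \<Rightarrow> ereal) \<Rightarrow> bool" where
  "harmonic F U u \<longleftrightarrow> (\<forall>x\<in>U. u x \<noteq> \<infinity> \<and> u x \<noteq> -\<infinity>) \<and> continuous_on U u \<and>
     subharmonic F U u \<and> subharmonic (dual_subeq F) U (\<lambda>x. - u x)"

definition local_defining_function :: "(real^'n) set \<Rightarrow> real^'n \<Rightarrow> (real^'n) set \<Rightarrow> (real^'n \<Rightarrow> real) \<Rightarrow> bool" where
  "local_defining_function \<Omega> x U \<rho> \<longleftrightarrow> open U \<and> x \<in> U \<and> smooth_on U \<rho> \<and>
     \<Omega> \<inter> U = {z \<in> U. \<rho> z < 0} \<and> (\<forall>z\<in>U. grad \<rho> z \<noteq> 0)"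

definition smooth_strictly_convex_boundary :: "(real^'n^'n) set \<Rightarrow> (real^'n) set \<Rightarrow> bool" where
  "smooth_strictly_convex_boundary F \<Omega> \<longleftrightarrow>
     (\<forall>x\<in>frontier \<Omega>. (\<exists>U \<rho>. local_defining_function \<Omega> x U \<rho>) \<and>
        (\<forall>U \<rho>. local_defining_function \<Omega> x U \<rho> \<longrightarrow>
           (\<exists>T. \<forall>t\<ge>T. hess \<rho> x + t *\<^sub>R proj_line (sgn (grad \<rho> x)) \<in> sym_interior F)))"

end

(* No comparison theorem for viscosity solutions is needed. Since - P_e lies outside F for every e,
   adding a large multiple of the square of a defining function rho to rho yields a smooth
   upper barrier at every smooth boundary point, both on the outer boundary and on the spheres;
   strict F-convexity turns the same function into a lower barrier on the outer boundary, and on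
   the spheres psi itself is a lower barrier. Comparing a subharmonic function with a smooth
   function whose Hessian avoids F is immediate from the definition, so the Perron function attains
   its boundary values continuously. As F has constant coefficients, Walsh's translation
   argument propagates this modulus of continuity to the interior, and a bump argument shows that
   the negative of the Perron function is subharmonic for the dual subequation. *)

theory Submission
  imports Defs
begin

text \<open>Perron's method usually compares upper and lower envelopes. Here continuity comes before
  subharmonicity, so no envelopes occur: the supremum is itself a competitor, and later
  modifications are glued onto it. Gluing requires the new piece to lie below the old one in a whole
  neighbourhood of the edge of its region. This dictates most constants: annuli of half the radius,
  and a loss of \<open>2 * \<epsilon>\<close> under translation, one \<open>\<epsilon>\<close> for
  the oscillation of the supremum near the boundary and one for its distance from a fixed
  competitor. The exclusion of \<open>- P_e\<close> works through a limit:
  \<open>X / t - P_e\<close> tends to \<open>- P_e\<close>, so closedness and the cone property push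
  \<open>X - t P_e\<close> out of \<open>F\<close> for large \<open>t\<close>, whatever
  \<open>X\<close> is. It also makes \<open>- (e \<bullet> z)^2\<close> a strict supersolution,
  which bounds the family above. In both cases psi is finite and continuous on the closure of the
  punctured domain, hence a competitor; it keeps the supremum finite, and the outer lower barriers
  are glued to it.\<close>

section \<open>Twice continuously differentiable functions\<close>

text \<open>Gradient and Hessian are carried as explicit witnesses, so that barriers can be
  assembled by rules for sums, multiples, squares and translates instead of unfolding iterated
  \<open>pd\<close>. Symmetry of \<open>A\<close> is a consequence, see
  \<open>C2_on_symmetric\<close>.\<close>

definition C2_on :: "(real^'n) set \<Rightarrow> (real^'n \<Rightarrow> real) \<Rightarrow> (real^'n \<Rightarrow> real^'n) \<Rightarrow>
    (real^'n \<Rightarrow> real^'n^'n) \<Rightarrow> bool" where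
  "C2_on S f g A \<longleftrightarrow> open S \<and>
     (\<forall>x\<in>S. (f has_derivative (\<lambda>h. g x \<bullet> h)) (at x) \<and> (g has_derivative (\<lambda>h. A x *v h)) (at x)) \<and>
     continuous_on S A"

lemma C2_onD:
  assumes "C2_on S f g A"
  shows "open S" "continuous_on S A"
    and "x \<in> S \<Longrightarrow> (f has_derivative (\<lambda>h. g x \<bullet> h)) (at x)"
    and "x \<in> S \<Longrightarrow> (g has_derivative (\<lambda>h. A x *v h)) (at x)"
  using assms by (auto simp: C2_on_def)

lemma C2_on_subset: "C2_on S f g A \<Longrightarrow> open T \<Longrightarrow> T \<subseteq> S \<Longrightarrow> C2_on T f g A"
  unfolding C2_on_def by (meson continuous_on_subset subsetD)

lemma C2_on_continuous: "C2_on S f g A \<Longrightarrow> continuous_on S f"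
  using continuous_on_eq_continuous_at[OF C2_onD(1)] C2_onD(3) has_derivative_continuous by blast

lemma continuous_on_matI:
  assumes "\<And>i j. continuous_on S (\<lambda>x. A x $ i $ j)"
  shows "continuous_on S (\<lambda>x. A x :: real^'n^'m)"
proof -
  have "continuous_on S (\<lambda>x. \<chi> i j. A x $ i $ j)"
    using assms by (intro continuous_on_vec_lambda)
  then show ?thesis by simp
qed

lemma pd_eq:
  assumes "(f has_derivative (\<lambda>h. v \<bullet> h)) (at x)"
  shows "pd i f x = v $ i"
  using frechet_derivative_at[OF assms, symmetric] by (simp add: pd_def inner_axis)

lemma pd_cong:
  assumes "open S" "x \<in> S" "\<And>z. z \<in> S \<Longrightarrow> f z = f' z"
  shows "pd i f x = pd i f' x"
proof -
  have "(f has_derivative D) (at x) \<longleftrightarrow> (f' has_derivative D) (at x)" for D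
    using has_derivative_transform_within_open[of f D x UNIV S f', OF _ assms(1,2)]
      has_derivative_transform_within_open[of f' D x UNIV S f, OF _ assms(1,2)] assms(3) by auto
  then show ?thesis by (simp add: pd_def frechet_derivative_def)
qed

lemma Ck_on_cong:
  assumes "open S" "\<And>z. z \<in> S \<Longrightarrow> f z = f' z" "Ck_on k S f"
  shows "Ck_on k S f'"
  using assms(2,3)
proof (induction k arbitrary: f f')
  case 0
  then show ?case by (simp cong: continuous_on_cong)
next
  case (Suc k)
  have "continuous_on S f'" using Suc.prems by (simp cong: continuous_on_cong)
  moreover have "f' differentiable (at x)" if "x \<in> S" for x
  proof -
    from Suc.prems that obtain D where "(f has_derivative D) (at x)"
      by (auto simp: differentiable_def)
    from has_derivative_transform_within_open[OF this assms(1) that] Suc.prems(1)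
    show ?thesis by (auto simp: differentiable_def)
  qed
  moreover have "Ck_on k S (pd i f')" for i
  proof (rule Suc.IH)
    show "pd i f z = pd i f' z" if "z \<in> S" for z
      using assms(1) that Suc.prems(1) by (rule pd_cong)
    show "Ck_on k S (pd i f)" using Suc.prems(2) by simp
  qed
  ultimately show ?case by simp
qed

lemma component_has_derivative:
  assumes "(g has_derivative (\<lambda>h. A *v h)) (at x)"
  shows "((\<lambda>z. g z $ i) has_derivative (\<lambda>h. row i A \<bullet> h)) (at x)"
proof -
  have "((\<lambda>z. g z $ i) has_derivative (\<lambda>h. (A *v h) $ i)) (at x)"
    using bounded_linear.has_derivative[OF bounded_linear_vec_nth assms] .
  then show ?thesis by (simp add: matrix_vector_mul_component row_def vec_lambda_eta)
qed

lemma C2_on_imp_Ck_on: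
  assumes C: "C2_on S f g A"
  shows "Ck_on 2 S f"
proof -
  note D = C2_onD[OF C]
  have gd: "((\<lambda>z. g z $ j) has_derivative (\<lambda>h. row j (A x) \<bullet> h)) (at x)" if "x \<in> S" for x j
    by (rule component_has_derivative[OF D(4)[OF that]])
  have cg: "continuous_on S (\<lambda>z. g z $ j)" for j
    unfolding continuous_on_eq_continuous_at[OF D(1)]
    using gd has_derivative_continuous by blast
  have cA: "continuous_on S (\<lambda>z. A z $ j $ i)" for i j
    using D(2) by (intro continuous_intros)
  have "Ck_on 0 S (pd i (\<lambda>z. g z $ j))" for i j
    by (rule Ck_on_cong[OF D(1), of "\<lambda>z. A z $ j $ i"]) (auto simp: cA pd_eq[OF gd] row_def)
  then have "Ck_on 1 S (\<lambda>z. g z $ j)" for j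
    using cg gd unfolding One_nat_def Ck_on.simps differentiable_def by blast
  then have "Ck_on 1 S (pd j f)" for j
    by (rule Ck_on_cong[OF D(1), rotated]) (simp add: pd_eq[OF D(3)])
  then have "Ck_on (Suc 1) S f"
    using C2_on_continuous[OF C] D(3) unfolding Ck_on.simps(2) differentiable_def by blast
  then show ?thesis by (simp add: numeral_2_eq_2)
qed

text \<open>The transpose reflects conventions: row \<open>j\<close> of \<open>A\<close>
  differentiates the \<open>j\<close>-th gradient component, whereas \<open>hess\<close> puts the
  outer derivative in the first index. It disappears in \<open>C2_on_hess_eq\<close>, once symmetry
  is known.\<close>

lemma C2_on_hess:
  assumes C: "C2_on S f g A" and x: "x \<in> S"
  shows "hess f x = transpose (A x)"
proof -
  note D = C2_onD[OF C]
  have "pd i (pd j f) x = A x $ j $ i" for i j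
  proof -
    have "pd i (pd j f) x = pd i (\<lambda>z. g z $ j) x"
      by (rule pd_cong[OF D(1) x]) (simp add: pd_eq[OF D(3)])
    also have "\<dots> = A x $ j $ i"
      using pd_eq[OF component_has_derivative[OF D(4)[OF x]]] by (simp add: row_def)
    finally show ?thesis .
  qed
  then show ?thesis by (simp add: hess_def transpose_def vec_eq_iff)
qed

lemma has_derivative_pd:
  assumes "f differentiable (at x)"
  shows "(f has_derivative (\<lambda>h. grad f x \<bullet> h)) (at x)"
proof -
  let ?D = "frechet_derivative f (at x)"
  have d: "(f has_derivative ?D) (at x)" using assms frechet_derivative_works by blast
  then have "linear ?D" by (rule has_derivative_linear)
  have "?D h = grad f x \<bullet> h" for h
  proof -
    have "?D h = ?D (\<Sum>i\<in>UNIV. h $ i *s axis i 1)" by (simp add: basis_expansion)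
    also have "\<dots> = (\<Sum>i\<in>UNIV. h $ i * ?D (axis i 1))"
      using \<open>linear ?D\<close> by (simp add: linear_sum linear_cmul scalar_mult_eq_scaleR)
    also have "\<dots> = grad f x \<bullet> h" by (simp add: grad_def pd_def inner_vec_def mult.commute)
    finally show ?thesis .
  qed
  then have "?D = (\<lambda>h. grad f x \<bullet> h)" by blast
  with d show ?thesis by simp
qed

lemma Ck_on_imp_C2_on:
  assumes S: "open S" and C: "Ck_on 2 S f"
  shows "C2_on S f (grad f) (\<lambda>x. transpose (hess f x))"
proof -
  have C2: "f differentiable (at x)" "pd j f differentiable (at x)" "continuous_on S (pd i (pd j f))"
    if "x \<in> S" for x i j
    using C that by (auto simp: numeral_2_eq_2)
  have "(grad f has_derivative (\<lambda>h. transpose (hess f x) *v h)) (at x)" if x: "x \<in> S" for x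
  proof -
    have "((\<lambda>z. grad f z $ j) has_derivative (\<lambda>h. (transpose (hess f x) *v h) $ j)) (at x)" for j
      using has_derivative_pd[OF C2(2)[OF x, of j]]
      by (simp add: grad_def hess_def transpose_def matrix_vector_mul_component)
    then show ?thesis
      by (subst has_derivative_componentwise_within) (auto simp: Basis_vec_def inner_axis)
  qed
  moreover have "continuous_on S (\<lambda>x. transpose (hess f x))"
  proof (rule continuous_on_matI)
    fix i j
    have "continuous_on S (pd j (pd i f))"
      using C by (auto simp: numeral_2_eq_2)
    then show "continuous_on S (\<lambda>x. transpose (hess f x) $ i $ j)"
      by (simp add: hess_def transpose_def)
  qed
  ultimately show ?thesis using S has_derivative_pd[OF C2(1)] by (auto simp: C2_on_def)
qed

section \<open>Symmetry of second derivatives and the second-order condition at a minimum\<close>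

lemma C2_on_second_difference:
  fixes a b :: "real^'n"
  assumes C: "C2_on S f g A" and "s > 0"
    and S: "\<And>\<xi> \<eta>. \<lbrakk>0 \<le> \<xi>; \<xi> \<le> s; 0 \<le> \<eta>; \<eta> \<le> s\<rbrakk> \<Longrightarrow> x + \<xi> *\<^sub>R a + \<eta> *\<^sub>R b \<in> S"
  shows "\<exists>\<xi> \<eta>. 0 \<le> \<xi> \<and> \<xi> \<le> s \<and> 0 \<le> \<eta> \<and> \<eta> \<le> s \<and>
    f (x + s *\<^sub>R a + s *\<^sub>R b) - f (x + s *\<^sub>R a) - f (x + s *\<^sub>R b) + f x =
      s * s * ((A (x + \<xi> *\<^sub>R a + \<eta> *\<^sub>R b) *v b) \<bullet> a)"
proof -
  note D = C2_onD[OF C]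
  \<comment> \<open>The summand \<open>0 *\<^sub>R b\<close> stays in place so that both terms are
    instances of \<open>d1\<close>, with \<open>c = s\<close> and \<open>c = 0\<close>. The mean
    value theorem is applied first along \<open>a\<close>, then along \<open>b\<close>.\<close>
  let ?d = "\<lambda>t. f (x + t *\<^sub>R a + s *\<^sub>R b) - f (x + t *\<^sub>R a + 0 *\<^sub>R b)"
  have d1: "((\<lambda>t. f (x + t *\<^sub>R a + c *\<^sub>R b)) has_derivative (\<lambda>h. g (x + t *\<^sub>R a + c *\<^sub>R b) \<bullet> (h *\<^sub>R a)))
      (at t within {0..s})" if "0 \<le> t" "t \<le> s" "0 \<le> c" "c \<le> s" for t c
  proof -
    have "((\<lambda>t. x + t *\<^sub>R a + c *\<^sub>R b) has_derivative (\<lambda>h. h *\<^sub>R a)) (at t within {0..s})"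
      by (auto intro!: derivative_eq_intros)
    from has_derivative_compose[OF this D(3)] S that show ?thesis by auto
  qed
  have "\<exists>\<xi>\<in>{0<..<s}. ?d s - ?d 0 =
      (\<lambda>h. g (x + \<xi> *\<^sub>R a + s *\<^sub>R b) \<bullet> (h *\<^sub>R a) - g (x + \<xi> *\<^sub>R a + 0 *\<^sub>R b) \<bullet> (h *\<^sub>R a)) (s - 0)"
  proof (rule mvt_simple[OF \<open>s > 0\<close>])
    fix t assume "0 \<le> t" "t \<le> s"
    with \<open>s > 0\<close> show "(?d has_derivative (\<lambda>h. g (x + t *\<^sub>R a + s *\<^sub>R b) \<bullet> (h *\<^sub>R a) - g (x + t *\<^sub>R a + 0 *\<^sub>R b) \<bullet> (h *\<^sub>R a)))
      (at t within {0..s})"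
      by (intro has_derivative_diff d1) auto
  qed
  then obtain \<xi> where \<xi>: "0 < \<xi>" "\<xi> < s" and 1: "?d s - ?d 0 =
      s * (g (x + \<xi> *\<^sub>R a + s *\<^sub>R b) \<bullet> a - g (x + \<xi> *\<^sub>R a + 0 *\<^sub>R b) \<bullet> a)"
    by (auto simp: right_diff_distrib)
  have "\<exists>\<eta>\<in>{0<..<s}. g (x + \<xi> *\<^sub>R a + s *\<^sub>R b) \<bullet> a - g (x + \<xi> *\<^sub>R a + 0 *\<^sub>R b) \<bullet> a =
      (\<lambda>h. (A (x + \<xi> *\<^sub>R a + \<eta> *\<^sub>R b) *v (h *\<^sub>R b)) \<bullet> a) (s - 0)"
  proof (rule mvt_simple[OF \<open>s > 0\<close>])
    fix t assume t: "0 \<le> t" "t \<le> s"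
    have "((\<lambda>t. x + \<xi> *\<^sub>R a + t *\<^sub>R b) has_derivative (\<lambda>h. h *\<^sub>R b)) (at t within {0..s})"
      by (auto intro!: derivative_eq_intros)
    from has_derivative_compose[OF this D(4)] S t \<xi>
    have "((\<lambda>t. g (x + \<xi> *\<^sub>R a + t *\<^sub>R b)) has_derivative (\<lambda>h. A (x + \<xi> *\<^sub>R a + t *\<^sub>R b) *v (h *\<^sub>R b)))
       (at t within {0..s})" by auto
    then show "((\<lambda>t. g (x + \<xi> *\<^sub>R a + t *\<^sub>R b) \<bullet> a) has_derivative
        (\<lambda>h. (A (x + \<xi> *\<^sub>R a + t *\<^sub>R b) *v (h *\<^sub>R b)) \<bullet> a)) (at t within {0..s})"
      by (rule has_derivative_inner_left)
  qed
  then obtain \<eta> where \<eta>: "0 < \<eta>" "\<eta> < s" and 2: "g (x + \<xi> *\<^sub>R a + s *\<^sub>R b) \<bullet> a - g (x + \<xi> *\<^sub>R a + 0 *\<^sub>R b) \<bullet> a =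
      s * ((A (x + \<xi> *\<^sub>R a + \<eta> *\<^sub>R b) *v b) \<bullet> a)"
    by (auto simp: matrix_vector_mult_scaleR)
  show ?thesis
    using 1 2 \<xi> \<eta> by (intro exI[of _ \<xi>] exI[of _ \<eta>]) (auto simp: algebra_simps)
qed

text \<open>The second difference over a small parallelogram is symmetric in \<open>a\<close> and
  \<open>b\<close>, and each order of differentiation expresses it by \<open>A\<close> at some point
  of the parallelogram. Continuity of \<open>A\<close> at \<open>x\<close> then forces the two
  bilinear values to agree.\<close>

lemma C2_on_symmetric:
  assumes C: "C2_on S f g A" and x: "x \<in> S"
  shows "A x \<in> sym_mats"
proof -
  note D = C2_onD[OF C]
  have eq: "(A x *v b) \<bullet> a = (A x *v a) \<bullet> b" for a b
  proof (rule ccontr)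
    assume ne: "(A x *v b) \<bullet> a \<noteq> (A x *v a) \<bullet> b"
    define e where "e = \<bar>(A x *v b) \<bullet> a - (A x *v a) \<bullet> b\<bar> / 2"
    have "e > 0" using ne by (simp add: e_def)
    have cont: "isCont (\<lambda>z. (A z *v b) \<bullet> a) x" for a b
    proof -
      have "continuous_on S (\<lambda>z. (A z *v b) \<bullet> a)"
        unfolding matrix_vector_mult_def inner_vec_def
        by (intro continuous_intros continuous_on_vec_lambda D(2))
      then show ?thesis using D(1) x continuous_on_eq_continuous_at by blast
    qed
    obtain d1 where d1: "d1 > 0" "\<And>z. dist z x < d1 \<Longrightarrow> \<bar>(A z *v b) \<bullet> a - (A x *v b) \<bullet> a\<bar> < e"
      using cont[of b a] \<open>e > 0\<close> unfolding continuous_at_eps_delta by (auto simp: dist_real_def)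
    obtain d2 where d2: "d2 > 0" "\<And>z. dist z x < d2 \<Longrightarrow> \<bar>(A z *v a) \<bullet> b - (A x *v a) \<bullet> b\<bar> < e"
      using cont[of a b] \<open>e > 0\<close> unfolding continuous_at_eps_delta by (auto simp: dist_real_def)
    obtain d3 where d3: "d3 > 0" "ball x d3 \<subseteq> S" using D(1) x open_contains_ball by blast
    define d where "d = min d1 (min d2 d3)"
    \<comment> \<open>Small enough for the whole parallelogram to stay within distance
      \<open>d\<close> of \<open>x\<close>; the \<open>+ 1\<close> keeps the denominator positive
      even when both vectors vanish.\<close>
    define s where "s = d / (2 * (norm a + norm b + 1))"
    have "d > 0" using d1 d2 d3 by (auto simp: d_def)
    moreover have n: "norm a + norm b + 1 > 0"
      by (smt (verit) norm_ge_zero)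
    ultimately have "s > 0" by (auto simp: s_def)
    have near: "dist (x + \<xi> *\<^sub>R a + \<eta> *\<^sub>R b) x < d" if "0 \<le> \<xi>" "\<xi> \<le> s" "0 \<le> \<eta>" "\<eta> \<le> s" for \<xi> \<eta>
    proof -
      have "dist (x + \<xi> *\<^sub>R a + \<eta> *\<^sub>R b) x = norm (\<xi> *\<^sub>R a + \<eta> *\<^sub>R b)"
        by (simp add: dist_norm algebra_simps)
      also have "\<dots> \<le> norm (\<xi> *\<^sub>R a) + norm (\<eta> *\<^sub>R b)" by (rule norm_triangle_ineq)
      also have "\<dots> \<le> s * norm a + s * norm b"
        using that by (auto intro!: add_mono mult_right_mono)
      also have "\<dots> = s * (norm a + norm b)" by (simp add: algebra_simps)
      also have "\<dots> < s * (2 * (norm a + norm b + 1))"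
        using \<open>s > 0\<close> norm_ge_zero[of a] norm_ge_zero[of b]
        by (intro mult_strict_left_mono, unfold distrib_left) linarith+
      also have "\<dots> = d" using n by (simp add: s_def)
      finally show ?thesis .
    qed
    have inS: "x + \<xi> *\<^sub>R a + \<eta> *\<^sub>R b \<in> S" if "0 \<le> \<xi>" "\<xi> \<le> s" "0 \<le> \<eta>" "\<eta> \<le> s" for \<xi> \<eta>
      using near[OF that] d3(2) by (auto simp: d_def dist_commute)
    then have inS': "x + \<xi> *\<^sub>R b + \<eta> *\<^sub>R a \<in> S" if "0 \<le> \<xi>" "\<xi> \<le> s" "0 \<le> \<eta>" "\<eta> \<le> s" for \<xi> \<eta>
      using that by (simp add: algebra_simps)
    from C2_on_second_difference[OF C \<open>s > 0\<close> inS] obtain \<xi> \<eta> where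
      1: "0 \<le> \<xi>" "\<xi> \<le> s" "0 \<le> \<eta>" "\<eta> \<le> s"
        "f (x + s *\<^sub>R a + s *\<^sub>R b) - f (x + s *\<^sub>R a) - f (x + s *\<^sub>R b) + f x =
      s * s * ((A (x + \<xi> *\<^sub>R a + \<eta> *\<^sub>R b) *v b) \<bullet> a)" by blast
    from C2_on_second_difference[OF C \<open>s > 0\<close> inS'] obtain \<xi>' \<eta>' where
      2: "0 \<le> \<xi>'" "\<xi>' \<le> s" "0 \<le> \<eta>'" "\<eta>' \<le> s"
        "f (x + s *\<^sub>R b + s *\<^sub>R a) - f (x + s *\<^sub>R b) - f (x + s *\<^sub>R a) + f x =
      s * s * ((A (x + \<xi>' *\<^sub>R b + \<eta>' *\<^sub>R a) *v a) \<bullet> b)" by blast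
    have "f (x + s *\<^sub>R a + s *\<^sub>R b) = f (x + s *\<^sub>R b + s *\<^sub>R a)" by (simp add: algebra_simps)
    then have "s * s * ((A (x + \<xi> *\<^sub>R a + \<eta> *\<^sub>R b) *v b) \<bullet> a) = s * s * ((A (x + \<xi>' *\<^sub>R b + \<eta>' *\<^sub>R a) *v a) \<bullet> b)"
      using 1(5) 2(5) by linarith
    then have "(A (x + \<xi> *\<^sub>R a + \<eta> *\<^sub>R b) *v b) \<bullet> a = (A (x + \<xi>' *\<^sub>R b + \<eta>' *\<^sub>R a) *v a) \<bullet> b"
      using \<open>s > 0\<close> by simp
    moreover have "\<bar>(A (x + \<xi> *\<^sub>R a + \<eta> *\<^sub>R b) *v b) \<bullet> a - (A x *v b) \<bullet> a\<bar> < e"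
      by (rule d1(2)) (use near[OF 1(1-4)] in \<open>auto simp: d_def\<close>)
    moreover have "\<bar>(A (x + \<xi>' *\<^sub>R b + \<eta>' *\<^sub>R a) *v a) \<bullet> b - (A x *v a) \<bullet> b\<bar> < e"
      by (rule d2(2)) (use near[OF 2(3,4,1,2)] in \<open>auto simp: d_def algebra_simps\<close>)
    moreover have "\<not> (\<bar>w - p\<bar> < \<bar>p - q\<bar> / 2 \<and> \<bar>w - q\<bar> < \<bar>p - q\<bar> / 2)" for w p q :: real
      by (auto simp: abs_if split: if_splits)
    ultimately show False unfolding e_def by metis
  qed
  have "A x $ i $ j = A x $ j $ i" for i j
    using eq[of "axis j 1" "axis i 1"]
    by (simp add: inner_axis matrix_vector_mult_basis column_def)
  then show ?thesis by (simp add: sym_mats_def transpose_def vec_eq_iff)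
qed

lemma C2_on_hess_eq:
  assumes "C2_on S f g A" "x \<in> S"
  shows "hess f x = A x"
  using C2_on_hess[OF assms] C2_on_symmetric[OF assms] by (simp add: sym_mats_def)

lemma C2_on_if_Ck_on:
  assumes "open S" "Ck_on 2 S f"
  shows "C2_on S f (grad f) (hess f)"
proof -
  note C = Ck_on_imp_C2_on[OF assms]
  have "transpose (hess f x) = hess f x" if "x \<in> S" for x
    using C2_on_hess_eq[OF C that] by simp
  with C show ?thesis by (auto simp: C2_on_def cong: continuous_on_cong)
qed

text \<open>The gradient vanishes at \<open>x\<close>. Were \<open>e \<bullet> (A x *v e)\<close>
  negative, it would stay negative nearby, and two mean value steps along \<open>e\<close>, from
  function to gradient and from gradient to Hessian, would make \<open>f\<close> drop below
  \<open>f x\<close>.\<close>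

lemma C2_on_local_min_psd:
  assumes C: "C2_on S f g A" and x: "x \<in> S" and min: "\<And>z. z \<in> S \<Longrightarrow> f x \<le> f z"
  shows "psd (A x)"
proof -
  note D = C2_onD[OF C]
  have "(\<lambda>v. g x \<bullet> v) = (\<lambda>v. 0)"
    using differential_zero_maxmin[OF x D(1) D(3)[OF x]] min by blast
  then have g0: "g x = 0" by (metis inner_eq_zero_iff)
  have "e \<bullet> (A x *v e) \<ge> 0" for e
  proof (rule ccontr)
    assume neg: "\<not> e \<bullet> (A x *v e) \<ge> 0"
    have "continuous_on S (\<lambda>z. e \<bullet> (A z *v e))"
      unfolding matrix_vector_mult_def inner_vec_def
      by (intro continuous_intros continuous_on_vec_lambda D(2))
    then have "isCont (\<lambda>z. e \<bullet> (A z *v e)) x" using D(1) x continuous_on_eq_continuous_at by blast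
    then obtain d1 where d1: "d1 > 0" "\<And>z. dist z x < d1 \<Longrightarrow> \<bar>e \<bullet> (A z *v e) - e \<bullet> (A x *v e)\<bar> < - (e \<bullet> (A x *v e))"
      using neg unfolding continuous_at_eps_delta dist_real_def
      by (metis neg_0_less_iff_less not_le)
    obtain d3 where d3: "d3 > 0" "ball x d3 \<subseteq> S" using D(1) x open_contains_ball by blast
    define s where "s = min d1 d3 / (2 * (norm e + 1))"
    have n: "norm e + 1 > 0" by (smt (verit) norm_ge_zero)
    then have s: "s > 0" using d1 d3 by (auto simp: s_def)
    have near: "dist (x + t *\<^sub>R e) x < min d1 d3" if "0 \<le> t" "t \<le> s" for t
    proof -
      have "dist (x + t *\<^sub>R e) x = t * norm e" using that by (simp add: dist_norm)
      also have "\<dots> \<le> s * norm e" using that by (simp add: mult_right_mono)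
      also have "\<dots> < s * (2 * (norm e + 1))"
        using s norm_ge_zero[of e] by (intro mult_strict_left_mono, unfold distrib_left) linarith+
      also have "\<dots> = min d1 d3" using n by (simp add: s_def)
      finally show ?thesis .
    qed
    have inS: "x + t *\<^sub>R e \<in> S" if "0 \<le> t" "t \<le> s" for t
      using near[OF that] d3(2) by (auto simp: dist_commute)
    have drv: "((\<lambda>t. x + t *\<^sub>R e) has_derivative (\<lambda>h. h *\<^sub>R e)) (at t within T)" for t T
      by (auto intro!: derivative_eq_intros)
    have "\<exists>\<xi>\<in>{0<..<s}. f (x + s *\<^sub>R e) - f (x + 0 *\<^sub>R e) = (\<lambda>h. g (x + \<xi> *\<^sub>R e) \<bullet> (h *\<^sub>R e)) (s - 0)"
      by (rule mvt_simple[OF s, where f = "\<lambda>t. f (x + t *\<^sub>R e)"])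
         (rule has_derivative_compose[OF drv D(3)], use inS in auto)
    then obtain \<xi> where \<xi>: "0 < \<xi>" "\<xi> < s" "f (x + s *\<^sub>R e) - f x = s * (g (x + \<xi> *\<^sub>R e) \<bullet> e)"
      by auto
    have "\<exists>\<eta>\<in>{0<..<\<xi>}. g (x + \<xi> *\<^sub>R e) \<bullet> e - g (x + 0 *\<^sub>R e) \<bullet> e = (\<lambda>h. (A (x + \<eta> *\<^sub>R e) *v (h *\<^sub>R e)) \<bullet> e) (\<xi> - 0)"
      by (rule mvt_simple[OF \<xi>(1), where f = "\<lambda>t. g (x + t *\<^sub>R e) \<bullet> e"])
         (rule has_derivative_inner_left, rule has_derivative_compose[OF drv D(4)], use inS \<xi> in auto)
    then obtain \<eta> where \<eta>: "0 < \<eta>" "\<eta> < \<xi>" "g (x + \<xi> *\<^sub>R e) \<bullet> e = \<xi> * (e \<bullet> (A (x + \<eta> *\<^sub>R e) *v e))"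
      using g0 by (auto simp: matrix_vector_mult_scaleR inner_commute)
    have "e \<bullet> (A (x + \<eta> *\<^sub>R e) *v e) < 0"
      using d1(2)[of "x + \<eta> *\<^sub>R e"] near[of \<eta>] \<eta> \<xi> by auto
    then have "s * (\<xi> * (e \<bullet> (A (x + \<eta> *\<^sub>R e) *v e))) < 0" using s \<xi> by (simp add: mult_pos_neg)
    then show False using \<xi>(3) \<eta>(3) min[OF inS[of s]] s by auto
  qed
  then show ?thesis using C2_on_symmetric[OF C x] by (simp add: psd_def)
qed

section \<open>Calculus rules for building barriers\<close>

lemma C2_on_const: "open S \<Longrightarrow> C2_on S (\<lambda>x. c) (\<lambda>x. 0) (\<lambda>x. 0)"
  by (simp add: C2_on_def)

lemma C2_on_add:
  assumes "C2_on S f g A" "C2_on S f' g' A'"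
  shows "C2_on S (\<lambda>x. f x + f' x) (\<lambda>x. g x + g' x) (\<lambda>x. A x + A' x)"
  using assms by (auto simp: C2_on_def inner_add_left matrix_vector_mult_add_rdistrib
      intro!: has_derivative_add continuous_intros)

lemma C2_on_cmult:
  assumes "C2_on S f g A"
  shows "C2_on S (\<lambda>x. c * f x) (\<lambda>x. c *\<^sub>R g x) (\<lambda>x. c *\<^sub>R A x)"
  using assms by (auto simp: C2_on_def scaleR_matrix_vector_assoc[symmetric]
      intro!: continuous_intros derivative_eq_intros)

text \<open>For a vector \<open>v\<close> of arbitrary length, \<^const>\<open>proj_line\<close> is the rank-one matrix
  \<open>v v\<^sup>T\<close>.\<close>

lemma proj_line_mult: "proj_line v *v h = (v \<bullet> h) *\<^sub>R v"
  by (simp add: proj_line_def matrix_vector_mult_def vec_eq_iff inner_vec_def sum_distrib_left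
      sum_distrib_right mult_ac)

lemma proj_line_sgn: "v \<noteq> 0 \<Longrightarrow> proj_line v = (norm v)\<^sup>2 *\<^sub>R proj_line (sgn v)"
proof -
  assume "v \<noteq> 0"
  then have n: "(norm v)\<^sup>2 * (inverse (norm v))\<^sup>2 = 1"
    by (simp add: power_inverse)
  have "(norm v)\<^sup>2 * ((inverse (norm v) * v $ i) * (inverse (norm v) * v $ j)) = v $ i * v $ j" for i j
    using arg_cong[OF n, of "\<lambda>t. t * (v $ i * v $ j)"] by (simp only: power2_eq_square mult_1 mult_ac)
  then show ?thesis
    by (simp add: proj_line_def sgn_div_norm vec_eq_iff)
qed

text \<open>The rank-one term is the source of the barriers: where \<open>f\<close> vanishes, adding
  a multiple of its square changes the Hessian only in the gradient direction, and by an arbitrary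
  amount.\<close>

lemma C2_on_square:
  assumes C: "C2_on S f g A"
  shows "C2_on S (\<lambda>x. (f x)\<^sup>2) (\<lambda>x. (2 * f x) *\<^sub>R g x) (\<lambda>x. 2 *\<^sub>R proj_line (g x) + (2 * f x) *\<^sub>R A x)"
proof -
  note D = C2_onD[OF C]
  have cg: "continuous_on S g"
    unfolding continuous_on_eq_continuous_at[OF D(1)]
    using D(4) has_derivative_continuous by blast
  have "continuous_on S (\<lambda>x. proj_line (g x))"
    unfolding proj_line_def by (intro continuous_on_vec_lambda continuous_intros cg)
  then have "continuous_on S (\<lambda>x. 2 *\<^sub>R proj_line (g x) + (2 * f x) *\<^sub>R A x)"
    by (intro continuous_intros C2_on_continuous[OF C] D(2))
  moreover have "((\<lambda>x. (2 * f x) *\<^sub>R g x) has_derivative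
      (\<lambda>h. (2 *\<^sub>R proj_line (g x) + (2 * f x) *\<^sub>R A x) *v h)) (at x)" if "x \<in> S" for x
    by (rule derivative_eq_intros D(3,4)[OF that] refl)+
      (auto simp: matrix_vector_mult_add_rdistrib scaleR_matrix_vector_assoc[symmetric] proj_line_mult algebra_simps)
  moreover have "((\<lambda>x. (f x)\<^sup>2) has_derivative (\<lambda>h. ((2 * f x) *\<^sub>R g x) \<bullet> h)) (at x)" if "x \<in> S" for x
    by (rule derivative_eq_intros D(3,4)[OF that] refl)+ (auto simp: algebra_simps)
  ultimately show ?thesis using D(1) by (simp add: C2_on_def)
qed

lemma C2_on_norm_square:
  assumes "open S"
  shows "C2_on S (\<lambda>x. (norm (x - y))\<^sup>2) (\<lambda>x. 2 *\<^sub>R (x - y)) (\<lambda>x. 2 *\<^sub>R mat 1)"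
proof -
  have "((\<lambda>x. (norm (x - y))\<^sup>2) has_derivative (\<lambda>h. (2 *\<^sub>R (x - y)) \<bullet> h)) (at x)" for x
    unfolding power2_norm_eq_inner
    by (rule derivative_eq_intros refl)+ (simp add: inner_commute)
  moreover have "((\<lambda>x. 2 *\<^sub>R (x - y)) has_derivative (\<lambda>h. (2 *\<^sub>R mat 1) *v h)) (at x)" for x
    by (rule derivative_eq_intros refl)+ (simp add: scaleR_matrix_vector_assoc[symmetric])
  ultimately show ?thesis using assms by (simp add: C2_on_def)
qed

lemma C2_on_inner: "open S \<Longrightarrow> C2_on S (\<lambda>x. e \<bullet> x) (\<lambda>x. e) (\<lambda>x. 0)"
  by (auto simp: C2_on_def intro!: derivative_eq_intros)

lemma C2_on_translate:
  assumes C: "C2_on S f g A"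
  shows "C2_on ((\<lambda>x. x + v) -` S) (\<lambda>x. f (x + v)) (\<lambda>x. g (x + v)) (\<lambda>x. A (x + v))"
proof -
  note D = C2_onD[OF C]
  have t: "((\<lambda>x. x + v) has_derivative (\<lambda>h. h)) (at x)" for x
    by (auto intro!: derivative_eq_intros)
  have "open ((\<lambda>x. x + v) -` S)"
    by (rule continuous_open_vimage[OF D(1)]) (auto intro: continuous_intros)
  moreover have "continuous_on ((\<lambda>x. x + v) -` S) (\<lambda>x. A (x + v))"
    by (rule continuous_on_compose2[OF D(2)]) (auto intro!: continuous_intros)
  ultimately show ?thesis
    using has_derivative_compose[OF t D(3)] has_derivative_compose[OF t D(4)]
    by (auto simp: C2_on_def)
qed

section \<open>Semicontinuous and subharmonic functions\<close>

lemma usc_on_subset: "usc_on S u \<Longrightarrow> T \<subseteq> S \<Longrightarrow> usc_on T u"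
  unfolding usc_on_def by (meson subsetD)

lemma usc_on_continuous:
  assumes "continuous_on S u"
  shows "usc_on S u"
  unfolding usc_on_def
proof (intro ballI allI impI)
  fix x c assume x: "x \<in> S" "u x < c"
  then obtain A where A: "open A" "x \<in> A" "\<forall>y\<in>S. y \<in> A \<longrightarrow> u y \<in> {..<c}"
    using assms unfolding continuous_on_topological by (metis lessThan_iff open_lessThan)
  then obtain e where "e > 0" "\<And>y. dist y x < e \<Longrightarrow> y \<in> A" unfolding open_dist by metis
  then show "\<exists>e>0. \<forall>y\<in>S. dist y x < e \<longrightarrow> u y < c" using A by blast
qed

lemma usc_on_max:
  assumes "usc_on S u" "usc_on S v"
  shows "usc_on S (\<lambda>z. max (u z) (v z))"
  unfolding usc_on_def
proof (intro ballI allI impI)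
  fix x c assume x: "x \<in> S" "max (u x) (v x) < c"
  obtain e1 where e1: "e1 > 0" "\<forall>y\<in>S. dist y x < e1 \<longrightarrow> u y < c"
    using assms(1) x unfolding usc_on_def by (metis max_less_iff_conj)
  obtain e2 where e2: "e2 > 0" "\<forall>y\<in>S. dist y x < e2 \<longrightarrow> v y < c"
    using assms(2) x unfolding usc_on_def by (metis max_less_iff_conj)
  show "\<exists>e>0. \<forall>y\<in>S. dist y x < e \<longrightarrow> max (u y) (v y) < c"
    using e1 e2 by (intro exI[of _ "min e1 e2"]) auto
qed

lemma usc_on_add_continuous:
  fixes w :: "real^'n \<Rightarrow> real"
  assumes u: "usc_on S u" "\<forall>z\<in>S. u z \<noteq> \<infinity>" and w: "continuous_on S w"
  shows "usc_on S (\<lambda>z. u z + ereal (w z))"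
  unfolding usc_on_def
proof (intro ballI allI impI)
  fix x c assume x: "x \<in> S" "u x + ereal (w x) < c"

  show "\<exists>e>0. \<forall>y\<in>S. dist y x < e \<longrightarrow> u y + ereal (w y) < c"
  proof (cases c)
    case PInf
    then show ?thesis using u(2) by (intro exI[of _ 1]) auto
  next
    case MInf
    then show ?thesis using x by simp
  next
    case (real c')
    obtain d where d: "u x < ereal d" "d < c' - w x"
    proof (cases "u x")
      case (real a)
      then show ?thesis using that[of "(a + (c' - w x)) / 2"] x(2) \<open>c = ereal c'\<close> by auto
    next
      case PInf
      then show ?thesis using u(2) x by auto
    next
      case MInf
      then show ?thesis using that[of "c' - w x - 1"] by auto
    qed
    obtain e1 where e1: "e1 > 0" "\<forall>y\<in>S. dist y x < e1 \<longrightarrow> u y < ereal d"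
      using u(1) x(1) d(1) unfolding usc_on_def by blast
    have "c' - d - w x > 0" using d by simp
    then obtain e2 where e2: "e2 > 0" "\<forall>y\<in>S. dist y x < e2 \<longrightarrow> \<bar>w y - w x\<bar> < c' - d - w x"
      using w x(1) unfolding continuous_on_iff dist_real_def by metis
    have "u y + ereal (w y) < c" if y: "y \<in> S" "dist y x < min e1 e2" for y
    proof -
      have "u y + ereal (w y) \<le> ereal d + ereal (w y)"
        using e1 y by (intro add_right_mono) auto
      also have "\<dots> < c" using e2(2) y real by force
      finally show ?thesis .
    qed
    then show ?thesis using e1(1) e2(1) by (intro exI[of _ "min e1 e2"]) auto
  qed
qed

lemma usc_on_translate:
  assumes "usc_on S u"
  shows "usc_on ((\<lambda>x. x + v) -` S) (\<lambda>x. u (x + v))"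
  unfolding usc_on_def
proof (intro ballI allI impI)
  fix x c assume "x \<in> (\<lambda>x. x + v) -` S" "u (x + v) < c"
  then obtain e where "e > 0" "\<forall>y\<in>S. dist y (x + v) < e \<longrightarrow> u y < c"
    using assms unfolding usc_on_def by (metis vimageD)
  then show "\<exists>e>0. \<forall>y\<in>(\<lambda>x. x + v) -` S. dist y x < e \<longrightarrow> u (y + v) < c"
    by (intro exI[of _ e]) auto
qed

text \<open>Upper semicontinuity can fail only through an upward jump where \<open>c\<close> is
  switched on. Near points outside \<open>B\<close> the assumption \<open>near\<close> makes
  \<open>c\<close> invisible in the maximum.\<close>

lemma usc_on_glue:
  assumes a: "usc_on K a" and c: "usc_on (K \<inter> B) c" and B: "open B"
    and near: "\<And>z. z \<in> K \<Longrightarrow> z \<notin> B \<Longrightarrow> \<exists>e>0. \<forall>y\<in>K \<inter> B. dist y z < e \<longrightarrow> c y \<le> a y"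
  shows "usc_on K (\<lambda>z. if z \<in> B then max (a z) (c z) else a z)"
  unfolding usc_on_def
proof (intro ballI allI impI)
  fix x l assume x: "x \<in> K" "(if x \<in> B then max (a x) (c x) else a x) < l"
  show "\<exists>e>0. \<forall>y\<in>K. dist y x < e \<longrightarrow> (if y \<in> B then max (a y) (c y) else a y) < l"
  proof (cases "x \<in> B")
    case True
    have "usc_on (K \<inter> B) (\<lambda>z. max (a z) (c z))"
      by (rule usc_on_max[OF usc_on_subset[OF a] c]) auto
    moreover have "max (a x) (c x) < l" using x True by simp
    ultimately obtain e1 where e1: "e1 > 0" "\<forall>y\<in>K \<inter> B. dist y x < e1 \<longrightarrow> max (a y) (c y) < l"
      using True x(1) unfolding usc_on_def by (metis IntI)
    obtain e2 where e2: "e2 > 0" "\<And>y. dist y x < e2 \<Longrightarrow> y \<in> B"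
      using B True unfolding open_dist by metis
    show ?thesis using e1 e2 by (intro exI[of _ "min e1 e2"]) auto
  next
    case False
    then have "a x < l" using x by simp
    then obtain e1 where e1: "e1 > 0" "\<forall>y\<in>K. dist y x < e1 \<longrightarrow> a y < l"
      using a x(1) unfolding usc_on_def by blast
    obtain e2 where e2: "e2 > 0" "\<forall>y\<in>K \<inter> B. dist y x < e2 \<longrightarrow> c y \<le> a y"
      using near[OF x(1) False] by blast
    have "c y < l" if "y \<in> K" "y \<in> B" "dist y x < min e1 e2" for y
      using e1(2) e2(2) that by (metis IntI le_less_trans min_less_iff_conj)
    then show ?thesis using e1 e2(1) by (intro exI[of _ "min e1 e2"]) auto
  qed
qed

text \<open>If the supremum is not attained, each point has a ball on which \<open>u\<close> stays
  below some constant less than the supremum; a finite subcover then contradicts its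
  minimality.\<close>

lemma usc_on_attains_max:
  assumes "compact X" "X \<noteq> {}" "usc_on X u"
  shows "\<exists>p\<in>X. \<forall>z\<in>X. u z \<le> u p"
proof (rule ccontr)
  assume no: "\<not> ?thesis"
  let ?s = "SUP z\<in>X. u z"
  have lt: "u p < ?s" if "p \<in> X" for p
  proof -
    from no that have "\<exists>z\<in>X. \<not> u z \<le> u p" by blast
    then obtain z where "z \<in> X" "u p < u z" by (auto simp: not_le)
    then show ?thesis by (meson SUP_upper less_le_trans)
  qed
  have "\<exists>c e. c < ?s \<and> e > 0 \<and> (\<forall>y\<in>X. dist y p < e \<longrightarrow> u y < c)" if p: "p \<in> X" for p
  proof -
    obtain c where "u p < c" "c < ?s" using dense[OF lt[OF p]] by blast
    with assms(3) p show ?thesis unfolding usc_on_def by metis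
  qed
  then obtain c e where ce: "\<And>p. p \<in> X \<Longrightarrow> c p < ?s" "\<And>p. p \<in> X \<Longrightarrow> e p > 0"
      "\<And>p y. p \<in> X \<Longrightarrow> y \<in> X \<Longrightarrow> dist y p < e p \<Longrightarrow> u y < c p" by metis
  obtain C where C: "C \<subseteq> X" "finite C" "X \<subseteq> (\<Union>p\<in>C. ball p (e p))"
    by (rule compactE_image[OF assms(1), of X "\<lambda>p. ball p (e p)"]) (use ce(2) in force)+
  then have "C \<noteq> {}" using assms(2) by auto
  define m where "m = Max (c ` C)"
  have "m < ?s" using C \<open>C \<noteq> {}\<close> ce(1) by (auto simp: m_def)
  have "?s \<le> m"
  proof (rule SUP_least)
    fix z assume z: "z \<in> X"
    then obtain p where p: "p \<in> C" "dist z p < e p" using C(3) by (auto simp: dist_commute)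
    then have "u z < c p" using ce(3) z C(1) by blast
    also have "c p \<le> m" using p C(2) by (auto simp: m_def)
    finally show "u z \<le> m" by simp
  qed
  with \<open>m < ?s\<close> show False by simp
qed

section \<open>Stability properties of subharmonic functions and comparison with smooth strict
  supersolutions\<close>

lemma subharmonic_subset: "subharmonic F U u \<Longrightarrow> V \<subseteq> U \<Longrightarrow> subharmonic F V u"
  unfolding subharmonic_def by (meson order_trans subsetD usc_on_subset)

lemma subharmonic_test:
  assumes "subharmonic F U u" "C2_on S f g A" "S \<subseteq> U" "y \<in> S"
    "\<And>z. z \<in> S \<Longrightarrow> u z \<le> ereal (f z)" "u y = ereal (f y)"
  shows "A y \<in> F"
proof -
  have "test_function u y S f"
    using assms C2_onD(1)[OF assms(2)] C2_on_imp_Ck_on[OF assms(2)] by (auto simp: test_function_def)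
  then have "hess f y \<in> F" using assms(1,3,4) unfolding subharmonic_def by blast
  then show ?thesis using C2_on_hess_eq[OF assms(2,4)] by simp
qed

lemma test_function_C2_on:
  "test_function u y S \<phi> \<Longrightarrow> C2_on S \<phi> (grad \<phi>) (hess \<phi>)"
  by (auto simp: test_function_def intro: C2_on_if_Ck_on)

text \<open>If \<open>\<phi>\<close> touches \<open>f\<close> from above, then
  \<open>\<phi> - f\<close> has a local minimum, so its Hessian is positive semidefinite, and
  \<open>F\<close> absorbs such matrices.\<close>

lemma C2_on_subharmonic:
  assumes F: "cone_subequation F" and C: "C2_on S f g A" and A: "\<And>z. z \<in> S \<Longrightarrow> A z \<in> F"
  shows "subharmonic F S (\<lambda>z. ereal (f z))"
  unfolding subharmonic_def
proof (intro conjI ballI allI impI)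
  show "usc_on S (\<lambda>z. ereal (f z))"
    using C2_on_continuous[OF C] by (intro usc_on_continuous continuous_intros)
  fix y T \<phi> assume y: "y \<in> S" and t: "T \<subseteq> S \<and> test_function (\<lambda>z. ereal (f z)) y T \<phi>"
  then have t': "T \<subseteq> S" "open T" "y \<in> T" "\<And>z. z \<in> T \<Longrightarrow> f z \<le> \<phi> z" "f y = \<phi> y"
    by (auto simp: test_function_def)
  have "C2_on T (\<lambda>z. \<phi> z + - 1 * f z) (\<lambda>z. grad \<phi> z + - 1 *\<^sub>R g z) (\<lambda>z. hess \<phi> z + - 1 *\<^sub>R A z)"
    using t t' by (intro C2_on_add C2_on_cmult test_function_C2_on[of "\<lambda>z. ereal (f z)" y] C2_on_subset[OF C]) auto
  from C2_on_local_min_psd[OF this t'(3)] t'(4,5) have "psd (hess \<phi> y + - 1 *\<^sub>R A y)" by auto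
  then have "A y + (hess \<phi> y + - 1 *\<^sub>R A y) \<in> F"
    using F A[OF y] unfolding cone_subequation_def by blast
  then show "hess \<phi> y \<in> F" by simp
qed simp

text \<open>This is where constant coefficients matter: one set \<open>F\<close> serves all base
  points, and Hessians ignore additive constants.\<close>

lemma subharmonic_translate:
  assumes u: "subharmonic F U u"
  shows "subharmonic F ((\<lambda>x. x + v) -` U) (\<lambda>x. u (x + v) + ereal c)"
  unfolding subharmonic_def
proof (intro conjI ballI allI impI)
  have fin: "\<forall>x\<in>U. u x \<noteq> \<infinity>" and usc: "usc_on U u" using u by (auto simp: subharmonic_def)
  show "usc_on ((\<lambda>x. x + v) -` U) (\<lambda>x. u (x + v) + ereal c)"
    by (rule usc_on_add_continuous[OF usc_on_translate[OF usc]]) (use fin in auto)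
  show "u (x + v) + ereal c \<noteq> \<infinity>" if "x \<in> (\<lambda>x. x + v) -` U" for x
    using fin that by auto
  fix y S \<phi> assume y: "y \<in> (\<lambda>x. x + v) -` U"
    and t: "S \<subseteq> (\<lambda>x. x + v) -` U \<and> test_function (\<lambda>x. u (x + v) + ereal c) y S \<phi>"
  let ?S = "(\<lambda>x. x + (- v)) -` S"
  note C' = C2_on_translate[OF test_function_C2_on[OF conjunct2[OF t]], of "- v"]
  have C: "C2_on ?S (\<lambda>x. \<phi> (x + (- v)) + - c) (\<lambda>x. grad \<phi> (x + (- v)) + 0) (\<lambda>x. hess \<phi> (x + (- v)) + 0)"
    by (intro C2_on_add C' C2_on_const C2_onD(1)[OF C'])
  have "(\<lambda>x. hess \<phi> (x + (- v)) + 0) (y + v) \<in> F"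
  proof (rule subharmonic_test[OF u C])
    show "?S \<subseteq> U"
    proof
      fix z assume "z \<in> ?S"
      then have "z + - v \<in> S" by simp
      with t have "z + - v + v \<in> U" by blast
      then show "z \<in> U" by simp
    qed
    show "y + v \<in> ?S" using t by (auto simp: test_function_def)
    show "u z \<le> ereal (\<phi> (z + - v) + - c)" if "z \<in> ?S" for z
    proof -
      have "u (z + - v + v) + ereal c \<le> ereal (\<phi> (z + - v))"
        using t that unfolding test_function_def by blast
      then show ?thesis by (cases "u z") (auto simp: algebra_simps)
    qed
    have "u (y + v) + ereal c = ereal (\<phi> y)" using t by (auto simp: test_function_def)
    then show "u (y + v) = ereal (\<phi> (y + v + - v) + - c)"
      by (cases "u (y + v)") auto
  qed
  then show "hess \<phi> y \<in> F" by simp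
qed

text \<open>At each point the glued function equals \<open>a\<close> or \<open>c\<close>, and a test
  function for it is then one for that piece, since the piece lies below the glued function
  nearby.\<close>

lemma subharmonic_glue:
  assumes a: "subharmonic F G a" and c: "subharmonic F (G \<inter> B) c" and B: "open B"
    and usc: "usc_on G (\<lambda>z. if z \<in> B then max (a z) (c z) else a z)"
  shows "subharmonic F G (\<lambda>z. if z \<in> B then max (a z) (c z) else a z)" (is "subharmonic F G ?v")
  unfolding subharmonic_def
proof (intro conjI ballI allI impI)
  show "?v z \<noteq> \<infinity>" if "z \<in> G" for z
    using a c that by (auto simp: subharmonic_def max_def)
  fix y S \<phi> assume y: "y \<in> G" and t: "S \<subseteq> G \<and> test_function ?v y S \<phi>"
  note C = test_function_C2_on[OF conjunct2[OF t]]
  have t': "open S" "y \<in> S" "\<And>z. z \<in> S \<Longrightarrow> ?v z \<le> ereal (\<phi> z)" "?v y = ereal (\<phi> y)" "S \<subseteq> G"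
    using t unfolding test_function_def by blast+
  show "hess \<phi> y \<in> F"
  proof (cases "?v y = a y")
    case True
    show ?thesis
    proof (rule subharmonic_test[OF a C t'(5,2)])
      show "a z \<le> ereal (\<phi> z)" if "z \<in> S" for z
        using t'(3)[OF that] by (auto split: if_splits)
      show "a y = ereal (\<phi> y)" using t'(4) True by simp
    qed
  next
    case False
    then have yB: "y \<in> B" "?v y = c y" by (auto simp: max_def split: if_splits)
    show ?thesis
    proof (rule subharmonic_test[OF c C2_on_subset[OF C, of "S \<inter> B"]])
      show "c z \<le> ereal (\<phi> z)" if "z \<in> S \<inter> B" for z
        using t'(3)[of z] that by auto
      show "c y = ereal (\<phi> y)" using t'(4) yB by simp
    qed (use t' B yB in auto)
  qed
qed (rule usc)

text \<open>A test function for \<open>H\<close> need not touch any single member. Adding the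
  penalty \<open>d |z - y|^2\<close> makes a nearly maximal member touch a vertical shift of it at
  some \<open>p\<close> close to \<open>y\<close>; this gives a matrix of \<open>F\<close> close to
  \<open>hess \<phi> y\<close>, and closedness of \<open>F\<close> finishes as \<open>d\<close>
  tends to 0.\<close>

lemma subharmonic_Sup:
  fixes F :: "(real^'n^'n) set"
  assumes F: "closed F" and V: "\<And>u. u \<in> V \<Longrightarrow> subharmonic F G u"
    and usc: "usc_on G H" and fin: "\<And>z. z \<in> G \<Longrightarrow> H z \<noteq> \<infinity>"
    and H: "\<And>z. z \<in> G \<Longrightarrow> H z = (SUP u\<in>V. u z)"
  shows "subharmonic F G H"
  unfolding subharmonic_def
proof (intro conjI ballI allI impI)
  fix y S \<phi> assume y: "y \<in> G" and t: "S \<subseteq> G \<and> test_function H y S \<phi>"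
  note C = test_function_C2_on[OF conjunct2[OF t]]
  have t': "open S" "y \<in> S" "\<And>z. z \<in> S \<Longrightarrow> H z \<le> ereal (\<phi> z)" "H y = ereal (\<phi> y)" "S \<subseteq> G"
    using t unfolding test_function_def by blast+
  have near: "\<exists>p\<in>S. dist p y < d \<and> hess \<phi> p + (2 * d) *\<^sub>R mat 1 \<in> F" if d: "d > 0" for d :: real
  proof -
    obtain s0 where s0: "s0 > 0" "cball y s0 \<subseteq> S" using t' open_contains_cball by blast
    define s where "s = min s0 d"
    have s: "s > 0" "cball y s \<subseteq> S" "s \<le> d" using s0 d by (auto simp: s_def)
    \<comment> \<open>The allowed deficit \<open>d * s\<^sup>2\<close> is exactly the penalty on the
      sphere of radius \<open>s\<close>, so the maximum of \<open>?q\<close> is attained strictly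
      inside the ball.\<close>
    have "ereal (\<phi> y - d * s\<^sup>2) < H y" using s d t'(4) by simp
    then obtain u where u: "u \<in> V" "ereal (\<phi> y - d * s\<^sup>2) < u y"
      using H[OF y] by (auto simp: less_SUP_iff)
    have uH: "u z \<le> ereal (\<phi> z)" if "z \<in> S" for z
    proof -
      have "z \<in> G" using that t' by blast
      then have "u z \<le> H z" using H u(1) by (metis SUP_upper)
      also have "\<dots> \<le> ereal (\<phi> z)" using t'(3)[OF that] .
      finally show ?thesis .
    qed
    let ?f = "\<lambda>z. \<phi> z + d * (norm (z - y))\<^sup>2"
    have Cf: "C2_on S ?f (\<lambda>z. grad \<phi> z + d *\<^sub>R 2 *\<^sub>R (z - y)) (\<lambda>z. hess \<phi> z + d *\<^sub>R 2 *\<^sub>R mat 1)"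
      using t'(1) by (intro C2_on_add C C2_on_cmult C2_on_norm_square)
    let ?q = "\<lambda>z. u z + ereal (- ?f z)"
    have "usc_on (cball y s) ?q"
    proof (rule usc_on_add_continuous)
      show "usc_on (cball y s) u"
        using V[OF u(1)] s(2) t'(5) by (meson subharmonic_def usc_on_subset order_trans)
      show "continuous_on (cball y s) (\<lambda>z. - ?f z)"
        using C2_on_continuous[OF Cf] s(2) by (intro continuous_on_minus) (rule continuous_on_subset)
      show "\<forall>z\<in>cball y s. u z \<noteq> \<infinity>" using uH s(2) by (metis PInfty_neq_ereal(1) ereal_infty_less_eq(1) subsetD)
    qed
    then obtain p where p: "p \<in> cball y s" "\<And>z. z \<in> cball y s \<Longrightarrow> ?q z \<le> ?q p"
      using usc_on_attains_max[of "cball y s" ?q] s(1) by auto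
    have qp: "ereal (- (d * s\<^sup>2)) < ?q p"
    proof -
      have "ereal (- (d * s\<^sup>2)) < ?q y" using u(2) by (cases "u y") auto
      also have "\<dots> \<le> ?q p" using p(2)[of y] s(1) by simp
      finally show ?thesis .
    qed
    have up: "u p \<le> ereal (\<phi> p)" using uH p(1) s(2) by blast
    then obtain a where a: "u p = ereal a" using qp by (cases "u p") auto
    then have "d * (norm (p - y))\<^sup>2 < d * s\<^sup>2" using qp up by auto
    then have "(norm (p - y))\<^sup>2 < s\<^sup>2" using d by simp
    then have ps: "dist p y < s" using s(1) by (metis dist_norm less_imp_le power_less_imp_less_base)
    have "(\<lambda>z. hess \<phi> z + d *\<^sub>R 2 *\<^sub>R mat 1 + 0) p \<in> F"
    proof (rule subharmonic_test[OF V[OF u(1)]])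
      \<comment> \<open>The constant \<open>a - ?f p\<close> moves the penalised test function so
        that it touches \<open>u\<close> at \<open>p\<close>.\<close>
      show "C2_on (ball y s) (\<lambda>z. ?f z + (a - ?f p)) (\<lambda>z. (grad \<phi> z + d *\<^sub>R 2 *\<^sub>R (z - y)) + 0)
          (\<lambda>z. hess \<phi> z + d *\<^sub>R 2 *\<^sub>R mat 1 + 0)"
        by (rule C2_on_add[OF C2_on_subset[OF Cf] C2_on_const])
          (use ball_subset_cball[of y s] s(2) in auto)
      show "u z \<le> ereal (?f z + (a - ?f p))" if "z \<in> ball y s" for z
        using p(2)[of z] that a by (cases "u z") (auto simp: algebra_simps)
      show "ball y s \<subseteq> G" using ball_subset_cball[of y s] s(2) t'(5) by blast
    qed (use a ps in \<open>auto simp: dist_commute\<close>)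
    then have "hess \<phi> p + (2 * d) *\<^sub>R mat 1 \<in> F" by (simp add: mult.commute)
    then show ?thesis using p(1) s ps by (intro bexI[of _ p]) auto
  qed
  have "\<forall>n. \<exists>p\<in>S. dist p y < inverse (real (Suc n)) \<and> hess \<phi> p + (2 * inverse (real (Suc n))) *\<^sub>R mat 1 \<in> F"
    using near by simp
  then obtain p where p: "\<And>n. p n \<in> S" "\<And>n. dist (p n) y < inverse (real (Suc n))"
      "\<And>n. hess \<phi> (p n) + (2 * inverse (real (Suc n))) *\<^sub>R mat 1 \<in> F" by metis
  have py: "p \<longlonglongrightarrow> y"
  proof (rule metric_tendsto_imp_tendsto[OF LIMSEQ_inverse_real_of_nat])
    show "\<forall>\<^sub>F n in sequentially. dist (p n) y \<le> dist (inverse (real (Suc n))) 0"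
      using p(2) by (simp add: less_imp_le del: of_nat_Suc)
  qed
  have "(\<lambda>n. hess \<phi> (p n) + (2 * inverse (real (Suc n))) *\<^sub>R mat 1) \<longlonglongrightarrow> hess \<phi> y + (2 * 0) *\<^sub>R mat 1"
    by (intro tendsto_intros LIMSEQ_inverse_real_of_nat continuous_on_tendsto_compose[OF C2_onD(2)[OF C] py])
      (use p(1) t' in auto)
  then show "hess \<phi> y \<in> F"
    using closed_sequentially[OF F, of "\<lambda>n. hess \<phi> (p n) + (2 * inverse (real (Suc n))) *\<^sub>R mat 1"] p(3) by simp
qed (use usc fin in auto)

text \<open>At a maximum point of \<open>u - w\<close> with positive value, \<open>u\<close> is
  finite and \<open>bd\<close> places the point in \<open>T\<close>; a vertical shift of
  \<open>w\<close> is then a test function for \<open>u\<close> whose Hessian lies outside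
  \<open>F\<close>.\<close>

lemma subharmonic_comparison:
  assumes u: "subharmonic F G u" and X: "compact X" "usc_on X u" "\<And>z. z \<in> X \<Longrightarrow> u z \<noteq> \<infinity>"
    and w: "continuous_on X w" and T: "T \<subseteq> G" "T \<subseteq> X" and C: "C2_on T w g A"
    and A: "\<And>z. z \<in> T \<Longrightarrow> A z \<notin> F" and bd: "\<And>z. z \<in> X \<Longrightarrow> z \<notin> T \<Longrightarrow> u z \<le> ereal (w z)"
    and z: "z \<in> X"
  shows "u z \<le> ereal (w z)"
proof -
  let ?q = "\<lambda>z. u z + ereal (- w z)"
  have "usc_on X ?q" using X w by (intro usc_on_add_continuous continuous_on_minus) auto
  then obtain p where p: "p \<in> X" "\<And>z. z \<in> X \<Longrightarrow> ?q z \<le> ?q p"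
    using usc_on_attains_max[of X ?q] X(1) z by auto
  have "?q p \<le> 0"
  proof (rule ccontr)
    assume pos: "\<not> ?q p \<le> 0"
    then obtain a where a: "u p = ereal a" using X(3)[OF p(1)] by (cases "u p") auto
    have pT: "p \<in> T" using bd[OF p(1)] pos a by auto
    have "(\<lambda>z. A z + 0) p \<in> F"
    proof (rule subharmonic_test[OF u _ T(1) pT])
      show "C2_on T (\<lambda>z. w z + (a - w p)) (\<lambda>z. g z + 0) (\<lambda>z. A z + 0)"
        using C2_onD(1)[OF C] by (intro C2_on_add C C2_on_const)
      show "u z \<le> ereal (w z + (a - w p))" if "z \<in> T" for z
        using p(2)[of z] that a T(2) by (cases "u z") (auto simp: algebra_simps)
    qed (use a in simp)
    then show False using A[OF pT] by simp
  qed
  then have "?q z \<le> 0" using p(2)[OF z] by (rule order_trans[rotated])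
  then show ?thesis by (cases "u z") auto
qed

section \<open>Perron's method\<close>

definition perron_family ::
    "(real^'n^'n) set \<Rightarrow> (real^'n) set \<Rightarrow> (real^'n \<Rightarrow> real) \<Rightarrow> (real^'n \<Rightarrow> ereal) set" where
  "perron_family F G b = {u. usc_on (closure G) u \<and> (\<forall>z\<in>closure G. u z \<noteq> \<infinity>) \<and>
     subharmonic F G u \<and> (\<forall>z\<in>frontier G. u z \<le> ereal (b z))}"

lemma perron_familyD:
  assumes "u \<in> perron_family F G b"
  shows "usc_on (closure G) u" "z \<in> closure G \<Longrightarrow> u z \<noteq> \<infinity>" "subharmonic F G u"
    "z \<in> frontier G \<Longrightarrow> u z \<le> ereal (b z)"
  using assms by (auto simp: perron_family_def)

text \<open>The common mechanism behind four modifications of a competitor: the maximum of two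
  competitors (\<open>B = UNIV\<close>, with \<open>near\<close> vacuous), a lowered translate, an
  interior bump, and a boundary barrier.\<close>

lemma perron_family_glue:
  assumes a: "a \<in> perron_family F G b" and B: "open B"
    and c: "usc_on (closure G \<inter> B) c" "subharmonic F (G \<inter> B) c"
    and cb: "\<And>z. z \<in> closure G \<inter> B \<Longrightarrow> c z \<noteq> \<infinity>" "\<And>z. z \<in> frontier G \<inter> B \<Longrightarrow> c z \<le> ereal (b z)"
    and near: "\<And>z. z \<in> closure G \<Longrightarrow> z \<notin> B \<Longrightarrow> \<exists>e>0. \<forall>y\<in>closure G \<inter> B. dist y z < e \<longrightarrow> c y \<le> a y"
  shows "(\<lambda>z. if z \<in> B then max (a z) (c z) else a z) \<in> perron_family F G b" (is "?v \<in> _")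
proof -
  note a' = perron_familyD[OF a]
  have usc: "usc_on (closure G) ?v" by (rule usc_on_glue[OF a'(1) c(1) B near])
  then have "subharmonic F G ?v"
    by (intro subharmonic_glue a'(3) c(2) B) (rule usc_on_subset[OF _ closure_subset])
  moreover have "?v z \<noteq> \<infinity>" if "z \<in> closure G" for z
    using a'(2) cb(1) that by (auto simp: max_def)
  moreover have "?v z \<le> ereal (b z)" if "z \<in> frontier G" for z
    using a'(4) cb(2) that by auto
  ultimately show ?thesis using usc by (auto simp: perron_family_def)
qed

lemma perron_family_max:
  assumes "u \<in> perron_family F G b" "v \<in> perron_family F G b"
  shows "(\<lambda>z. max (u z) (v z)) \<in> perron_family F G b"
  using perron_family_glue[OF assms(1), of UNIV v] perron_familyD[OF assms(2)] by auto

lemma perron_family_finite_max: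
  assumes "finite C" "u0 \<in> perron_family F G b" "\<And>y. y \<in> C \<Longrightarrow> U y \<in> perron_family F G b"
  shows "\<exists>v\<in>perron_family F G b. \<forall>y\<in>C. \<forall>z. U y z \<le> v z"
  using assms(1,3)
proof (induction C)
  case empty
  then show ?case using assms(2) by auto
next
  case (insert x C)
  then obtain v where v: "v \<in> perron_family F G b" "\<forall>y\<in>C. \<forall>z. U y z \<le> v z" by auto
  have "(\<lambda>z. max (v z) (U x z)) \<in> perron_family F G b"
    using v(1) insert.prems by (intro perron_family_max) auto
  moreover have "\<forall>y\<in>insert x C. \<forall>z. U y z \<le> max (v z) (U x z)"
    using v(2) by (auto simp: le_max_iff_disj)
  ultimately show ?case by (intro bexI)
qed

lemma cone_subequation_scaleR_iff:
  assumes F: "cone_subequation F" and t: "t > 0"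
  shows "t *\<^sub>R A \<in> F \<longleftrightarrow> A \<in> F"
proof -
  have im: "s *\<^sub>R B \<in> F" if "s > 0" "B \<in> F" for s B
    using F that unfolding cone_subequation_def by blast
  show ?thesis
    using im[of t A] im[of "inverse t" "t *\<^sub>R A"] t by auto
qed

lemma compact_continuous_bound:
  fixes f :: "'a::topological_space \<Rightarrow> real"
  assumes "compact S" "continuous_on S f"
  obtains M where "\<And>y. y \<in> S \<Longrightarrow> f y \<le> M"
proof (cases "S = {}")
  case False
  then obtain p where "\<forall>y\<in>S. f y \<le> f p" using continuous_attains_sup[OF assms(1) False assms(2)] by blast
  then show ?thesis using that by blast
qed (use that in auto)

text \<open>Isolates Perron's method from the geometry: only barriers at each boundary point and one
  nowhere infinite competitor remain. The upper barrier does not involve \<open>b\<close>, because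
  multiplication by a positive constant keeps Hessians outside the cone; the lower barrier must be a
  global competitor.\<close>

locale perron_dirichlet =
  fixes F :: "(real^'n^'n) set" and G :: "(real^'n) set" and b :: "real^'n \<Rightarrow> real"
  assumes cone: "cone_subequation F"
    and neg_proj: "\<And>e. norm e = 1 \<Longrightarrow> - proj_line e \<notin> F"
    and openG: "open G" and boundedG: "bounded G"
    and cont_b: "continuous_on (frontier G) b"
    and upper_barrier: "\<And>y. y \<in> frontier G \<Longrightarrow> \<exists>s>0. \<exists>w g A. C2_on (ball y s) w g A \<and> w y = 0 \<and>
      (\<forall>z\<in>closure G \<inter> ball y s. z \<noteq> y \<longrightarrow> 0 < w z) \<and> (\<forall>z\<in>ball y s. A z \<notin> F)"
    and lower_barrier: "\<And>y \<epsilon>. y \<in> frontier G \<Longrightarrow> \<epsilon> > 0 \<Longrightarrow> \<exists>u\<in>perron_family F G b. \<exists>d>0.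
      \<forall>z\<in>closure G. dist z y < d \<longrightarrow> ereal (b y - \<epsilon>) \<le> u z"
    and base: "\<exists>u\<in>perron_family F G b. \<forall>z\<in>closure G. u z \<noteq> - \<infinity>"
begin

abbreviation V where "V \<equiv> perron_family F G b"

definition H :: "real^'n \<Rightarrow> ereal" where "H z = (SUP u\<in>V. u z)"

definition h :: "real^'n \<Rightarrow> real" where "h z = real_of_ereal (H z)"

section \<open>Upper bound, finiteness and boundary values of the Perron function\<close>

lemma closedF: "closed F"
  using cone by (simp add: cone_subequation_def)

lemma closure_eq: "closure G = G \<union> frontier G"
  by (simp add: closure_Un_frontier Un_commute)

lemma not_frontier: "z \<in> G \<Longrightarrow> z \<notin> frontier G"
  using openG by (simp add: frontier_def interior_open)

lemma compact_closure: "compact (closure G)"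
  using boundedG by (simp add: compact_closure)

lemma compact_frontier: "compact (frontier G)"
  using boundedG by (simp add: compact_frontier_bounded)

lemma H_upper: "u \<in> V \<Longrightarrow> u z \<le> H z"
  unfolding H_def by (rule SUP_upper)

text \<open>The function \<open>M + R - (e \<bullet> z)^2\<close> has Hessian
  \<open>- 2 proj_line e\<close>, which is outside \<open>F\<close>, and \<open>R\<close>
  compensates the subtracted square so that it dominates \<open>b\<close> on the frontier.\<close>

lemma uniform_bound: "\<exists>M. \<forall>u\<in>V. \<forall>z\<in>closure G. u z \<le> ereal M"
proof -
  obtain M where M: "\<And>y. y \<in> frontier G \<Longrightarrow> b y \<le> M"
    using compact_continuous_bound[OF compact_frontier cont_b] by blast
  obtain e :: "real^'n" where e: "norm e = 1"
    using vector_choose_size[of 1] by auto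
  have "continuous_on (closure G) (\<lambda>z. (e \<bullet> z)\<^sup>2)" by (intro continuous_intros)
  then obtain R where R: "\<And>y. y \<in> closure G \<Longrightarrow> (e \<bullet> y)\<^sup>2 \<le> R"
    using compact_continuous_bound[OF compact_closure] by blast
  have C: "C2_on G (\<lambda>z. (M + R) + - 1 * (e \<bullet> z)\<^sup>2) (\<lambda>z. 0 + - 1 *\<^sub>R ((2 * (e \<bullet> z)) *\<^sub>R e))
      (\<lambda>z. 0 + - 1 *\<^sub>R (2 *\<^sub>R proj_line e + (2 * (e \<bullet> z)) *\<^sub>R 0))"
    by (intro C2_on_add C2_on_const C2_on_cmult C2_on_square C2_on_inner openG)
  have "u z \<le> ereal (M + R)" if u: "u \<in> V" and z: "z \<in> closure G" for u z
  proof -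
    note u' = perron_familyD[OF u]
    have "u z \<le> ereal ((M + R) + - 1 * (e \<bullet> z)\<^sup>2)"
    proof (rule subharmonic_comparison[OF u'(3) compact_closure u'(1,2) _ order_refl closure_subset C])
      show "continuous_on (closure G) (\<lambda>z. (M + R) + - 1 * (e \<bullet> z)\<^sup>2)"
        by (intro continuous_intros)
      have "0 + - 1 *\<^sub>R (2 *\<^sub>R proj_line e + (2 * (e \<bullet> x)) *\<^sub>R 0) = 2 *\<^sub>R (- proj_line e)" for x
        by simp
      then show "0 + - 1 *\<^sub>R (2 *\<^sub>R proj_line e + (2 * (e \<bullet> x)) *\<^sub>R 0) \<notin> F" for x
        using neg_proj[OF e] cone_subequation_scaleR_iff[OF cone, of 2 "- proj_line e"]
        by (metis zero_less_numeral)
      show "u x \<le> ereal ((M + R) + - 1 * (e \<bullet> x)\<^sup>2)" if "x \<in> closure G" "x \<notin> G" for x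
      proof -
        have x: "x \<in> frontier G" using that closure_eq by auto
        have "u x \<le> ereal (b x)" by (rule u'(4)[OF x])
        also have "b x \<le> (M + R) + - 1 * (e \<bullet> x)\<^sup>2"
          using M[OF x] R[OF that(1)] by simp
        finally show ?thesis by simp
      qed
    qed (use z in auto)
    also have "\<dots> \<le> ereal (M + R)" by simp
    finally show ?thesis .
  qed
  then show ?thesis by blast
qed

lemma H_eq: "z \<in> closure G \<Longrightarrow> H z = ereal (h z)"
proof -
  assume z: "z \<in> closure G"
  obtain u where u: "u \<in> V" "u z \<noteq> - \<infinity>" using base z by blast
  then have "H z \<noteq> - \<infinity>" using H_upper[OF u(1), of z] by auto
  moreover obtain M where "\<forall>u\<in>V. u z \<le> ereal M" using uniform_bound z by blast
  then have "H z \<le> ereal M" unfolding H_def by (intro SUP_least) auto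
  ultimately show ?thesis unfolding h_def by (cases "H z") auto
qed

lemma member_le_h: "u \<in> V \<Longrightarrow> z \<in> closure G \<Longrightarrow> u z \<le> ereal (h z)"
  using H_upper H_eq by metis

lemma h_le:
  assumes "z \<in> closure G" "\<And>u. u \<in> V \<Longrightarrow> u z \<le> ereal c"
  shows "h z \<le> c"
proof -
  have "H z \<le> ereal c" unfolding H_def using assms(2) by (rule SUP_least)
  then show ?thesis using H_eq[OF assms(1)] by simp
qed

text \<open>Every competitor is compared with \<open>b y + \<epsilon> + c * w\<close> near
  \<open>y\<close>. The constants are independent of the competitor, so the bound passes to the
  supremum.\<close>

lemma boundary_upper:
  assumes y: "y \<in> frontier G" and \<epsilon>: "\<epsilon> > 0"
  shows "\<exists>d>0. \<forall>z\<in>closure G. dist z y < d \<longrightarrow> h z \<le> b y + 2 * \<epsilon>"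
proof -
  obtain s w g A where s: "s > 0" and C: "C2_on (ball y s) w g A" and wy: "w y = 0"
    and w: "\<And>z. z \<in> closure G \<Longrightarrow> z \<in> ball y s \<Longrightarrow> z \<noteq> y \<Longrightarrow> 0 < w z"
    and A: "\<And>z. z \<in> ball y s \<Longrightarrow> A z \<notin> F"
    using upper_barrier[OF y] by blast
  obtain M where M: "\<And>u z. u \<in> V \<Longrightarrow> z \<in> closure G \<Longrightarrow> u z \<le> ereal M"
    using uniform_bound by blast
  obtain d0 where d0: "d0 > 0" "\<And>z. z \<in> frontier G \<Longrightarrow> dist z y < d0 \<Longrightarrow> \<bar>b z - b y\<bar> < \<epsilon>"
    using cont_b y \<epsilon> unfolding continuous_on_iff dist_real_def by metis
  define d where "d = min d0 (s / 2)"
  have d: "d > 0" "d \<le> d0" "d < s" using d0 s by (auto simp: d_def)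
  then have sub: "cball y d \<subseteq> ball y s" by auto
  have wc: "continuous_on (ball y s) w" by (rule C2_on_continuous[OF C])
  let ?S = "closure G \<inter> sphere y d"
  have "compact ?S" using compact_closure by (intro compact_Int_closed) auto
  have "\<exists>\<delta>>0. \<forall>z\<in>?S. \<delta> \<le> w z"
  proof (cases "?S = {}")
    case False
    have "continuous_on ?S w"
      by (rule continuous_on_subset[OF wc]) (use sub in auto)
    then obtain p where p: "p \<in> ?S" "\<forall>z\<in>?S. w p \<le> w z"
      using continuous_attains_inf[OF \<open>compact ?S\<close> False] by blast
    moreover have "w p > 0" using w[of p] p(1) sub d by auto
    ultimately show ?thesis by blast
  qed (auto intro: exI[of _ 1])
  then obtain \<delta> where \<delta>: "\<delta> > 0" "\<And>z. z \<in> ?S \<Longrightarrow> \<delta> \<le> w z" by blast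
  \<comment> \<open>On the sphere \<open>w\<close> is at least \<open>\<delta>\<close>, so this
    factor lifts the barrier above the uniform bound \<open>M\<close> there. Inside the ball the
    term \<open>\<epsilon>\<close> absorbs the oscillation of \<open>b\<close>.\<close>
  define c where "c = (\<bar>M - b y\<bar> + 1) / \<delta>"
  have c: "c > 0" "c * \<delta> = \<bar>M - b y\<bar> + 1" using \<delta>(1) by (auto simp: c_def)
  have bound: "u z \<le> ereal ((b y + \<epsilon>) + c * w z)" if u: "u \<in> V" and z: "z \<in> closure G" "z \<in> cball y d" for u z
  proof (rule subharmonic_comparison[where X = "closure G \<inter> cball y d" and T = "G \<inter> ball y d"])
    note u' = perron_familyD[OF u]
    show "subharmonic F G u" by (rule u'(3))
    show "compact (closure G \<inter> cball y d)" using compact_closure by (intro compact_Int_closed) auto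
    show "usc_on (closure G \<inter> cball y d) u" using u'(1) by (rule usc_on_subset) auto
    show "continuous_on (closure G \<inter> cball y d) (\<lambda>z. (b y + \<epsilon>) + c * w z)"
      by (intro continuous_intros continuous_on_subset[OF wc]) (use sub in auto)
    show "G \<inter> ball y d \<subseteq> closure G \<inter> cball y d"
      using closure_subset[of G] by auto
    show "C2_on (G \<inter> ball y d) (\<lambda>z. (b y + \<epsilon>) + c * w z) (\<lambda>z. 0 + c *\<^sub>R g z) (\<lambda>z. 0 + c *\<^sub>R A z)"
      using openG sub by (intro C2_on_add C2_on_const C2_on_cmult C2_on_subset[OF C]) (auto simp: d(3) less_imp_le intro: less_trans)
    show "0 + c *\<^sub>R A x \<notin> F" if "x \<in> G \<inter> ball y d" for x
      using A[of x] that d cone_subequation_scaleR_iff[OF cone c(1)] by auto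
    show "u x \<le> ereal ((b y + \<epsilon>) + c * w x)" if x: "x \<in> closure G \<inter> cball y d" "x \<notin> G \<inter> ball y d" for x
    proof (cases "dist y x = d")
      case True
      then have "\<delta> \<le> w x" using x by (intro \<delta>(2)) auto
      then have "c * \<delta> \<le> c * w x" using c(1) by simp
      then have "M \<le> (b y + \<epsilon>) + c * w x" using c(2) \<epsilon> by linarith
      then show ?thesis using M[OF u, of x] x(1) by (metis IntD1 ereal_less_eq(3) order_trans)
    next
      case False
      then have xd: "dist y x < d" using x by auto
      then have xf: "x \<in> frontier G" using x closure_eq by auto
      have "0 \<le> w x" using w[of x] wy x xd d by (cases "x = y") auto
      then have "0 \<le> c * w x" using c(1) by simp
      moreover have "\<bar>b x - b y\<bar> < \<epsilon>" using d0(2)[OF xf] xd d by (simp add: dist_commute)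
      ultimately have "b x \<le> (b y + \<epsilon>) + c * w x" by linarith
      then show ?thesis using u'(4)[OF xf] by (metis ereal_less_eq(3) order_trans)
    qed
  qed (use z perron_familyD(2)[OF u] in auto)
  have "\<epsilon> / c > 0" using \<epsilon> c by simp
  moreover have "y \<in> ball y s" using s by simp
  ultimately obtain d1 where d1: "d1 > 0" "\<And>z. z \<in> ball y s \<Longrightarrow> dist z y < d1 \<Longrightarrow> \<bar>w z - w y\<bar> < \<epsilon> / c"
    using wc unfolding continuous_on_iff dist_real_def by metis
  have "h z \<le> b y + 2 * \<epsilon>" if z: "z \<in> closure G" "dist z y < min d d1" for z
  proof (rule h_le[OF z(1)])
    fix u assume "u \<in> V"
    then have "u z \<le> ereal ((b y + \<epsilon>) + c * w z)" using bound z by (auto simp: dist_commute)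
    also have "\<bar>w z - w y\<bar> < \<epsilon> / c" using d1(2)[of z] z d by (auto simp: dist_commute)
    then have "c * w z \<le> \<epsilon>" using c(1) wy by (auto simp: field_simps abs_less_iff)
    then have "ereal ((b y + \<epsilon>) + c * w z) \<le> ereal (b y + 2 * \<epsilon>)" by simp
    finally show "u z \<le> ereal (b y + 2 * \<epsilon>)" .
  qed
  then show ?thesis using d d1 by (intro exI[of _ "min d d1"]) auto
qed

lemma h_frontier: "y \<in> frontier G \<Longrightarrow> h y = b y"
proof (rule antisym)
  assume y: "y \<in> frontier G"
  then have yc: "y \<in> closure G" using closure_eq by auto
  show "h y \<le> b y" by (rule h_le[OF yc]) (rule perron_familyD(4)[OF _ y])
  show "b y \<le> h y"
  proof (rule field_le_epsilon)
    fix e :: real assume "e > 0"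
    from lower_barrier[OF y this] obtain u where "u \<in> V" "ereal (b y - e) \<le> u y"
      using yc by (metis dist_self)
    then have "ereal (b y - e) \<le> ereal (h y)" using member_le_h[OF _ yc] order_trans by blast
    then show "b y \<le> h y + e" by simp
  qed
qed

text \<open>Compactness makes the pointwise barriers uniform. The maximum \<open>v\<close> of
  finitely many lower barriers is one competitor within \<open>\<epsilon>\<close> of
  \<open>h\<close> all along the boundary; the translation argument needs it to hide the edge of a
  translate.\<close>

lemma collar:
  assumes \<epsilon>: "\<epsilon> > 0"
  shows "\<exists>N \<delta>. \<exists>v\<in>V. open N \<and> frontier G \<subseteq> N \<and> \<delta> > 0 \<and>
    (\<forall>z\<in>closure G \<inter> N. \<forall>z'\<in>closure G. dist z z' < \<delta> \<longrightarrow> \<bar>h z - h z'\<bar> \<le> \<epsilon> \<and> ereal (h z' - \<epsilon>) \<le> v z')"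
proof -
  have "\<exists>d. \<exists>u\<in>V. d > 0 \<and> (\<forall>z\<in>closure G. dist z y < d \<longrightarrow>
      \<bar>h z - b y\<bar> \<le> \<epsilon> / 2 \<and> ereal (b y - \<epsilon> / 2) \<le> u z)" if y: "y \<in> frontier G" for y
  proof -
    obtain d1 where d1: "d1 > 0" "\<forall>z\<in>closure G. dist z y < d1 \<longrightarrow> h z \<le> b y + 2 * (\<epsilon> / 4)"
      using boundary_upper[OF y, of "\<epsilon> / 4"] \<epsilon> by auto
    obtain u d2 where d2: "u \<in> V" "d2 > 0" "\<forall>z\<in>closure G. dist z y < d2 \<longrightarrow> ereal (b y - \<epsilon> / 2) \<le> u z"
      using lower_barrier[OF y, of "\<epsilon> / 2"] \<epsilon> by auto
    have "b y - \<epsilon> / 2 \<le> h z" if "z \<in> closure G" "dist z y < d2" for z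
    proof -
      have "ereal (b y - \<epsilon> / 2) \<le> u z" using d2(3) that by blast
      also have "\<dots> \<le> ereal (h z)" by (rule member_le_h[OF d2(1) that(1)])
      finally show ?thesis by simp
    qed
    then have "\<bar>h z - b y\<bar> \<le> \<epsilon> / 2" if "z \<in> closure G" "dist z y < min d1 d2" for z
      using d1(2) that unfolding abs_le_iff by fastforce
    then show ?thesis using d1(1) d2
      by (intro exI[of _ "min d1 d2"] bexI[of _ u]) auto
  qed
  then obtain d U where dU: "\<And>y. y \<in> frontier G \<Longrightarrow> U y \<in> V" "\<And>y. y \<in> frontier G \<Longrightarrow> d y > 0"
    "\<And>y z. y \<in> frontier G \<Longrightarrow> z \<in> closure G \<Longrightarrow> dist z y < d y \<Longrightarrow>
       \<bar>h z - b y\<bar> \<le> \<epsilon> / 2 \<and> ereal (b y - \<epsilon> / 2) \<le> U y z"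
    by metis
  obtain C where C: "C \<subseteq> frontier G" "finite C" "frontier G \<subseteq> (\<Union>y\<in>C. ball y (d y / 2))"
    by (rule compactE_image[OF compact_frontier, of "frontier G" "\<lambda>y. ball y (d y / 2)"]) (use dU(2) in force)+
  obtain u0 where u0: "u0 \<in> V" using base by blast
  have "\<exists>v\<in>V. \<forall>y\<in>C. \<forall>z. U y z \<le> v z"
    by (rule perron_family_finite_max[OF C(2) u0]) (use dU(1) C(1) in auto)
  then obtain v where v: "v \<in> V" "\<And>y z. y \<in> C \<Longrightarrow> U y z \<le> v z" by blast
  \<comment> \<open>Half radii serve both as cover and as margin: a point within
    \<open>\<delta>\<close> of a point of \<open>ball y (d y / 2)\<close> is still within
    \<open>d y\<close> of \<open>y\<close>. The inserted 1 keeps \<open>Min\<close> meaningful when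
    \<open>C\<close> is empty.\<close>
  define \<delta> where "\<delta> = Min (insert 1 ((\<lambda>y. d y / 2) ` C))"
  have \<delta>: "\<delta> > 0" using C dU(2) by (auto simp: \<delta>_def)
  have \<delta>C: "\<delta> \<le> d y / 2" if "y \<in> C" for y
    unfolding \<delta>_def using C(2) that by (intro Min_le) auto
  define N where "N = (\<Union>y\<in>C. ball y (d y / 2))"
  have N: "open N" "frontier G \<subseteq> N" using C(3) by (auto simp: N_def)
  have main: "\<bar>h z - h z'\<bar> \<le> \<epsilon> \<and> ereal (h z' - \<epsilon>) \<le> v z'"
    if z: "z \<in> closure G" "z \<in> N" and z': "z' \<in> closure G" "dist z z' < \<delta>" for z z'
  proof -
    obtain y where y: "y \<in> C" "dist z y < d y / 2" using z(2) by (auto simp: N_def dist_commute)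
    have yf: "y \<in> frontier G" using y C by blast
    have "dist z' y \<le> dist z z' + dist z y" by (metis dist_commute dist_triangle)
    then have 1: "dist z' y < d y" using y z'(2) \<delta>C[OF y(1)] by linarith
    have 2: "dist z y < d y" using y(2) zero_le_dist[of z y] by linarith
    note e1 = dU(3)[OF yf z'(1) 1] and e2 = dU(3)[OF yf z(1) 2]
    have "\<bar>h z - h z'\<bar> \<le> \<epsilon>" using e1 e2 by linarith
    moreover have "h z' - \<epsilon> \<le> b y - \<epsilon> / 2" using e1 by linarith
    then have "ereal (h z' - \<epsilon>) \<le> v z'" using e1 v(2)[OF y(1), of z'] by (meson ereal_less_eq(3) order_trans)
    ultimately show ?thesis by blast
  qed
  show ?thesis
    by (rule exI[of _ N], rule exI[of _ \<delta>], rule bexI[OF _ v(1)]) (use \<delta> N main in blast)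
qed

text \<open>Walsh's translation argument: a translate of a competitor, lowered by the oscillation in the
  collar and glued to the competitor itself, is again a competitor.\<close>

lemma interior_modulus:
  assumes \<epsilon>: "\<epsilon> > 0"
  shows "\<exists>\<delta>>0. \<forall>z\<in>G. \<forall>z'\<in>G. dist z z' < \<delta> \<longrightarrow> h z' \<le> h z + 2 * \<epsilon>"
proof -
  obtain N \<delta> v where v: "v \<in> V" and N: "open N" "frontier G \<subseteq> N" and \<delta>: "\<delta> > 0"
    and col: "\<And>z z'. z \<in> closure G \<Longrightarrow> z \<in> N \<Longrightarrow> z' \<in> closure G \<Longrightarrow> dist z z' < \<delta> \<Longrightarrow>
      \<bar>h z - h z'\<bar> \<le> \<epsilon> \<and> ereal (h z' - \<epsilon>) \<le> v z'"
    using collar[OF \<epsilon>] by blast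
  have "h z' \<le> h z + 2 * \<epsilon>" if z: "z \<in> G" "z' \<in> G" "dist z z' < \<delta>" for z z'
  proof (rule h_le)
    show "z' \<in> closure G" using z closure_subset by blast
    fix u assume u: "u \<in> V"
    define t where "t = z' - z"
    have t: "dist (x + t) x < \<delta>" for x using z(3) by (simp add: t_def dist_norm norm_minus_commute)
    \<comment> \<open>Taking the maximum with \<open>v\<close> costs nothing for the final estimate
      and guarantees \<open>h - \<epsilon> \<le> ?a\<close> on the collar.\<close>
    let ?a = "\<lambda>x. max (u x) (v x)" and ?B = "(\<lambda>x. x + t) -` G"
    \<comment> \<open>Near the boundary \<open>h\<close> changes by at most
      \<open>\<epsilon>\<close> under the translation, so \<open>?c \<le> h - \<epsilon>\<close>
      there. That is below \<open>v\<close>, hence below \<open>?a\<close>, and on the frontier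
      below \<open>b\<close>.\<close>
    let ?c = "\<lambda>x. ?a (x + t) + ereal (- (2 * \<epsilon>))"
    have a: "?a \<in> V" by (rule perron_family_max[OF u v])
    note a' = perron_familyD[OF a]
    have B: "open ?B" by (rule continuous_open_vimage[OF openG]) (auto intro: continuous_intros)
    have inB: "x + t \<in> closure G" if "x \<in> ?B" for x using that closure_subset by blast
    have c_bound: "?c x \<le> ereal (h x - \<epsilon>)"
      if x: "x \<in> closure G" "x + t \<in> closure G" "x \<in> N \<or> x + t \<in> N" for x
    proof -
      have "\<bar>h (x + t) - h x\<bar> \<le> \<epsilon>"
        using x col[of x "x + t"] col[of "x + t" x] t[of x] by (auto simp: dist_commute abs_minus_commute)
      moreover have "?a (x + t) \<le> ereal (h (x + t))" by (rule member_le_h[OF a x(2)])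
      ultimately show ?thesis by (cases "?a (x + t)") auto
    qed
    let ?w = "\<lambda>x. if x \<in> ?B then max (?a x) (?c x) else ?a x"
    have "?w \<in> V"
    proof (rule perron_family_glue[OF a B])
      show "usc_on (closure G \<inter> ?B) ?c"
      proof (rule usc_on_add_continuous)
        show "usc_on (closure G \<inter> ?B) (\<lambda>x. ?a (x + t))"
          by (rule usc_on_subset[OF usc_on_translate[OF a'(1)]]) (use inB in auto)
        show "\<forall>x\<in>closure G \<inter> ?B. ?a (x + t) \<noteq> \<infinity>" using a'(2) inB by blast
      qed auto
      show "subharmonic F (G \<inter> ?B) ?c"
        using subharmonic_translate[OF a'(3), of t "- (2 * \<epsilon>)"] by (rule subharmonic_subset) auto
      show "?c x \<noteq> \<infinity>" if "x \<in> closure G \<inter> ?B" for x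
        using a'(2)[OF inB, of x] that by auto
      show "?c x \<le> ereal (b x)" if x: "x \<in> frontier G \<inter> ?B" for x
      proof -
        have "?c x \<le> ereal (h x - \<epsilon>)"
          using x N closure_eq inB by (intro c_bound) auto
        also have "\<dots> \<le> ereal (b x)" using h_frontier[of x] x \<epsilon> by simp
        finally show ?thesis .
      qed
      \<comment> \<open>At the edge of \<open>?B\<close> the translated point is either on the
        frontier of \<open>G\<close>, so that nearby translates lie in the collar, or outside the
        closure, so that no point of \<open>?B\<close> is close.\<close>
      show "\<exists>e>0. \<forall>y\<in>closure G \<inter> ?B. dist y x < e \<longrightarrow> ?c y \<le> ?a y" if x: "x \<in> closure G" "x \<notin> ?B" for x
      proof (cases "x + t \<in> closure G")
        case True
        then have "x + t \<in> N" using x closure_eq N by auto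
        then obtain e where e: "e > 0" "\<And>y. dist y (x + t) < e \<Longrightarrow> y \<in> N"
          using N(1) unfolding open_dist by metis
        have "?c y \<le> ?a y" if y: "y \<in> closure G \<inter> ?B" "dist y x < e" for y
        proof -
          have yN: "y + t \<in> N" using e(2)[of "y + t"] y by simp
          have "?c y \<le> ereal (h y - \<epsilon>)" using y inB yN by (intro c_bound) auto
          also have "\<dots> \<le> v y" using col[of "y + t" y] y inB yN t[of y] by auto
          also have "\<dots> \<le> ?a y" by simp
          finally show ?thesis .
        qed
        then show ?thesis using e(1) by blast
      next
        case False
        then have "x + t \<in> - closure G" by simp
        then obtain e where e: "e > 0" "\<And>y. dist y (x + t) < e \<Longrightarrow> y \<in> - closure G"
          using open_Compl[OF closed_closure[of G]] unfolding open_dist by metis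
        have "\<not> dist y x < e" if "y \<in> ?B" for y
          using e(2)[of "y + t"] inB[OF that] by auto
        then show ?thesis using e(1) by blast
      qed
    qed
    then have "?w z \<le> ereal (h z)" using z closure_subset by (intro member_le_h) auto
    moreover have "z + t = z'" by (simp add: t_def)
    ultimately have "max (?a z) (?a z' + ereal (- (2 * \<epsilon>))) \<le> ereal (h z)" using z(2) by simp
    then have "?a z' + ereal (- (2 * \<epsilon>)) \<le> ereal (h z)" by simp
    then have "?a z' \<le> ereal (h z + 2 * \<epsilon>)" by (cases "?a z'") auto
    then show "u z' \<le> ereal (h z + 2 * \<epsilon>)" by simp
  qed
  then show ?thesis using \<delta> by blast
qed

lemma continuous_h: "continuous_on (closure G) h"
  unfolding continuous_on_iff
proof (intro ballI allI impI)
  fix x and e :: real assume x: "x \<in> closure G" and e: "e > 0"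
  show "\<exists>d>0. \<forall>x'\<in>closure G. dist x' x < d \<longrightarrow> dist (h x') (h x) < e"
  proof (cases "x \<in> G")
    case True
    have "e / 4 > 0" using e by simp
    from interior_modulus[OF this] obtain \<delta> where \<delta>: "\<delta> > 0"
      "\<And>z z'. z \<in> G \<Longrightarrow> z' \<in> G \<Longrightarrow> dist z z' < \<delta> \<Longrightarrow> h z' \<le> h z + 2 * (e / 4)" by blast
    obtain d where d: "d > 0" "\<And>z. dist z x < d \<Longrightarrow> z \<in> G" using True openG unfolding open_dist by metis
    have "dist (h z) (h x) < e" if "dist z x < min d \<delta>" for z
    proof -
      have "h z \<le> h x + 2 * (e / 4)" "h x \<le> h z + 2 * (e / 4)"
        using \<delta>(2) d(2) True that by (auto simp: dist_commute)
      then show ?thesis using e by (auto simp: dist_real_def abs_less_iff)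
    qed
    then show ?thesis using d \<delta> by (intro exI[of _ "min d \<delta>"]) auto
  next
    case False
    then have xf: "x \<in> frontier G" using x closure_eq by auto
    have "e / 2 > 0" using e by simp
    from collar[OF this] obtain N \<delta> where N: "frontier G \<subseteq> N" "\<delta> > 0"
      "\<And>z z'. z \<in> closure G \<inter> N \<Longrightarrow> z' \<in> closure G \<Longrightarrow> dist z z' < \<delta> \<Longrightarrow> \<bar>h z - h z'\<bar> \<le> e / 2" by blast
    have "dist (h z) (h x) < e" if "z \<in> closure G" "dist z x < \<delta>" for z
    proof -
      have "\<bar>h x - h z\<bar> \<le> e / 2" using N xf x that by (intro N(3)) (auto simp: dist_commute)
      then show ?thesis using e by (simp add: dist_real_def abs_minus_commute)
    qed
    then show ?thesis using N(2) by blast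
  qed
qed

section \<open>Harmonicity of the Perron function\<close>

lemma continuous_H: "continuous_on (closure G) H"
proof -
  have "continuous_on (closure G) (\<lambda>z. ereal (h z))" by (intro continuous_intros continuous_h)
  then show ?thesis by (simp add: H_eq cong: continuous_on_cong)
qed

text \<open>Continuity supplies the semicontinuity that \<open>subharmonic_Sup\<close> assumes, so
  the supremum is the largest competitor and can serve as the base of a gluing.\<close>

lemma H_in_family: "H \<in> V"
proof -
  have usc: "usc_on (closure G) H" by (rule usc_on_continuous[OF continuous_H])
  have "subharmonic F G H"
  proof (rule subharmonic_Sup[OF closedF, of V])
    show "usc_on G H" by (rule usc_on_subset[OF usc closure_subset])
    show "H z \<noteq> \<infinity>" if "z \<in> G" for z
      using H_eq[of z] closure_subset[of G] that by auto
  qed (auto simp: H_def perron_familyD(3))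
  moreover have "H z \<le> ereal (b z)" if "z \<in> frontier G" for z
    using H_eq[of z] h_frontier[OF that] that closure_eq by auto
  ultimately show ?thesis using usc H_eq by (auto simp: perron_family_def)
qed

text \<open>If \<open>- hess \<phi> y\<close> were interior to \<open>F\<close>, then
  \<open>- \<phi>\<close>, bent down by a small paraboloid and raised by \<open>\<eta>\<close>,
  would be subharmonic near \<open>y\<close>. Glued onto \<open>H\<close> it would give a competitor
  exceeding \<open>H\<close> at \<open>y\<close>.\<close>

lemma dual_subharmonic: "subharmonic (dual_subeq F) G (\<lambda>z. - H z)"
  unfolding subharmonic_def
proof (intro conjI ballI allI impI)
  have HG: "H z = ereal (h z)" if "z \<in> G" for z using H_eq that closure_subset by blast
  have "continuous_on G (\<lambda>z. ereal (- h z))"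
    by (intro continuous_intros continuous_on_subset[OF continuous_h closure_subset])
  then show "usc_on G (\<lambda>z. - H z)"
    by (intro usc_on_continuous) (simp add: HG cong: continuous_on_cong)
  show "- H z \<noteq> \<infinity>" if "z \<in> G" for z using HG[OF that] by simp
  fix y S \<phi> assume y: "y \<in> G" and t: "S \<subseteq> G \<and> test_function (\<lambda>z. - H z) y S \<phi>"
  note C = test_function_C2_on[OF conjunct2[OF t]]
  have t': "open S" "y \<in> S" "S \<subseteq> G" using t unfolding test_function_def by blast+
  have t\<phi>: "- \<phi> z \<le> h z" if "z \<in> S" for z
  proof -
    have "- H z \<le> ereal (\<phi> z)" using t that unfolding test_function_def by blast
    then show ?thesis using HG[of z] t'(3) that by auto
  qed
  have "- H y = ereal (\<phi> y)" using t unfolding test_function_def by blast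
  then have t\<phi>y: "h y = - \<phi> y" using HG[OF y] by auto
  have "- hess \<phi> y \<notin> sym_interior F"
  proof
    assume "- hess \<phi> y \<in> sym_interior F"
    then obtain e where e: "e > 0" "\<And>B. B \<in> sym_mats \<Longrightarrow> dist B (- hess \<phi> y) < e \<Longrightarrow> B \<in> F"
      by (auto simp: sym_interior_def)
    \<comment> \<open>The paraboloid then moves the Hessian by at most \<open>e / 2\<close>; the
      other half of the tolerance \<open>e\<close> is for the variation of
      \<open>hess \<phi>\<close> over the ball.\<close>
    define a where "a = e / (4 * (norm (mat 1 :: real^'n^'n) + 1))"
    have n: "norm (mat 1 :: real^'n^'n) + 1 > 0" by (smt (verit) norm_ge_zero)
    then have a: "a > 0" using e by (simp add: a_def)
    have "(2 * a) * norm (mat 1 :: real^'n^'n) \<le> (2 * a) * (norm (mat 1 :: real^'n^'n) + 1)"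
      using a by (intro mult_left_mono) auto
    also have "\<dots> = e / 2"
    proof -
      have "2 * (e / (4 * q)) * q = e / 2" if "q > 0" for q using that by (simp add: field_simps)
      from this[OF n] show ?thesis by (simp only: a_def)
    qed
    finally have na: "(2 * a) * norm (mat 1 :: real^'n^'n) \<le> e / 2" .
    obtain s1 where s1: "s1 > 0" "\<And>z. dist z y < s1 \<Longrightarrow> z \<in> S" using t'(1,2) unfolding open_dist by metis
    have "e / 2 > 0" using e by simp
    then obtain s2 where s2: "s2 > 0" "\<And>z. z \<in> S \<Longrightarrow> dist z y < s2 \<Longrightarrow> dist (hess \<phi> z) (hess \<phi> y) < e / 2"
      using C2_onD(2)[OF C] t'(2) unfolding continuous_on_iff by metis
    define s where "s = min s1 s2"
    have s: "s > 0" using s1 s2 by (simp add: s_def)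
    have sS: "ball y s \<subseteq> S" using s1 by (auto simp: s_def dist_commute)
    \<comment> \<open>The lift equals the drop of the paraboloid at distance \<open>s / 2\<close>,
      so the bump lies below \<open>H\<close> throughout the outer half of the ball, which contains
      every point of the ball within \<open>s / 2\<close> of its complement.\<close>
    define \<eta> where "\<eta> = a * (s / 2)\<^sup>2"
    have \<eta>: "\<eta> > 0" using a s by (simp add: \<eta>_def)
    let ?f = "\<lambda>z. (- 1 * \<phi> z + - a * (norm (z - y))\<^sup>2) + \<eta>"
    let ?A = "\<lambda>z. (- 1 *\<^sub>R hess \<phi> z + - a *\<^sub>R 2 *\<^sub>R mat 1) + 0"
    have Cf: "C2_on (ball y s) ?f (\<lambda>z. (- 1 *\<^sub>R grad \<phi> z + - a *\<^sub>R 2 *\<^sub>R (z - y)) + 0) ?A"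
      by (intro C2_on_add C2_on_cmult C2_on_const C2_on_norm_square C2_on_subset[OF C] sS open_ball)
    have "?A z \<in> F" if z: "z \<in> ball y s" for z
    proof (rule e(2))
      show "?A z \<in> sym_mats" using C2_on_symmetric[OF Cf z] .
      have "dist (?A z) (- hess \<phi> y) = norm ((hess \<phi> z - hess \<phi> y) + (2 * a) *\<^sub>R mat 1)"
        unfolding dist_norm by (subst norm_minus_cancel[symmetric]) (simp add: algebra_simps)
      also have "\<dots> \<le> dist (hess \<phi> z) (hess \<phi> y) + (2 * a) * norm (mat 1 :: real^'n^'n)"
        unfolding dist_norm by (rule norm_triangle_le) (use a in simp)
      also have "\<dots> < e"
        using s2(2)[of z] z sS na by (force simp: s_def dist_commute)
      finally show "dist (?A z) (- hess \<phi> y) < e" .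
    qed
    then have sub: "subharmonic F (ball y s) (\<lambda>z. ereal (?f z))"
      by (rule C2_on_subharmonic[OF cone Cf])
    let ?v = "\<lambda>z. if z \<in> ball y s then max (H z) (ereal (?f z)) else H z"
    have "?v \<in> V"
    proof (rule perron_family_glue[OF H_in_family open_ball])
      show "usc_on (closure G \<inter> ball y s) (\<lambda>z. ereal (?f z))"
        using C2_on_continuous[OF Cf] by (intro usc_on_continuous continuous_on_ereal) (rule continuous_on_subset, auto)
      show "subharmonic F (G \<inter> ball y s) (\<lambda>z. ereal (?f z))" using sub by (rule subharmonic_subset) auto
      show "ereal (?f z) \<le> ereal (b z)" if "z \<in> frontier G \<inter> ball y s" for z
        using that sS t'(3) not_frontier by blast
      show "\<exists>e>0. \<forall>x\<in>closure G \<inter> ball y s. dist x z < e \<longrightarrow> ereal (?f x) \<le> H x"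
        if z: "z \<in> closure G" "z \<notin> ball y s" for z
      proof (intro exI conjI ballI impI)
        show "s / 2 > 0" using s by simp
        fix x assume x: "x \<in> closure G \<inter> ball y s" "dist x z < s / 2"
        have "dist y z \<le> dist x y + dist x z" by (metis dist_commute dist_triangle)
        then have "s / 2 \<le> norm (x - y)" using z x(2) by (simp add: dist_norm)
        then have "(s / 2)\<^sup>2 \<le> (norm (x - y))\<^sup>2" using s by (intro power_mono) auto
        then have "\<eta> \<le> a * (norm (x - y))\<^sup>2" using a by (simp add: \<eta>_def)
        then have "?f x \<le> h x" using t\<phi>[of x] x(1) sS by auto
        moreover have "x \<in> G" using x(1) sS t'(3) by blast
        ultimately show "ereal (?f x) \<le> H x" using HG[of x] by simp
      qed
    qed auto
    then have "?v y \<le> H y" by (rule H_upper)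
    then have "ereal (?f y) \<le> H y" using s by simp
    then show False using HG[OF y] t\<phi>y \<eta> by simp
  qed
  moreover have "hess \<phi> y \<in> sym_mats" by (rule C2_on_symmetric[OF C t'(2)])
  ultimately show "hess \<phi> y \<in> dual_subeq F" by (simp add: dual_subeq_def)
qed

theorem perron_solution:
  shows "\<forall>z\<in>closure G. H z \<noteq> \<infinity> \<and> H z \<noteq> - \<infinity>" "continuous_on (closure G) H"
    "harmonic F G H" "\<forall>z\<in>frontier G. H z = ereal (b z)"
proof -
  show fin: "\<forall>z\<in>closure G. H z \<noteq> \<infinity> \<and> H z \<noteq> - \<infinity>" by (simp add: H_eq)
  show "continuous_on (closure G) H" by (rule continuous_H)
  then have "continuous_on G H" by (rule continuous_on_subset[OF _ closure_subset])
  then show "harmonic F G H"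
    using fin closure_subset[of G] perron_familyD(3)[OF H_in_family] dual_subharmonic
    unfolding harmonic_def by blast
  show "\<forall>z\<in>frontier G. H z = ereal (b z)" using H_eq h_frontier closure_eq by auto
qed

end

section \<open>Barriers\<close>

lemma C2_on_hess_near:
  assumes C: "C2_on S f g A" and y: "y \<in> S" and W: "open W" "A y \<in> W"
  shows "\<exists>s>0. ball y s \<subseteq> S \<and> (\<forall>z\<in>ball y s. A z \<in> W)"
proof -
  note D = C2_onD[OF C]
  obtain T where T: "open T" "y \<in> T" "\<forall>z\<in>S. z \<in> T \<longrightarrow> A z \<in> W"
    using D(2) y W unfolding continuous_on_topological by metis
  have "open (S \<inter> T)" "y \<in> S \<inter> T" using T D(1) y by auto
  then obtain s where "s > 0" "ball y s \<subseteq> S \<inter> T" unfolding open_contains_ball by blast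
  then show ?thesis using T(3) by (intro exI[of _ s]) blast
qed

text \<open>The witness is \<open>\<rho> + M \<rho>^2 - c |z - y|^2\<close>. Near \<open>y\<close>
  one has \<open>|M \<rho>| < 1\<close>, so \<open>\<rho> (1 + M \<rho>) \<le> 0\<close> on
  \<open>K\<close> for \<open>M\<close> of either sign, and the last term makes the inequality
  strict away from \<open>y\<close>.\<close>

lemma barrier_function:
  assumes C: "C2_on U \<rho> g A" and y: "y \<in> U" "\<rho> y = 0"
    and neg: "\<And>z. z \<in> K \<Longrightarrow> z \<in> U \<Longrightarrow> \<rho> z \<le> 0" and c: "c > 0"
  shows "\<exists>s>0. \<exists>\<beta> g' B. ball y s \<subseteq> U \<and> C2_on (ball y s) \<beta> g' B \<and> \<beta> y = 0 \<and>
    (\<forall>z\<in>K \<inter> ball y s. z \<noteq> y \<longrightarrow> \<beta> z < 0) \<and> B y = A y + (2 * M) *\<^sub>R proj_line (g y) - (2 * c) *\<^sub>R mat 1"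
proof -
  let ?\<beta> = "\<lambda>z. (\<rho> z + M * (\<rho> z)\<^sup>2) + - c * (norm (z - y))\<^sup>2"
  let ?B = "\<lambda>z. (A z + M *\<^sub>R (2 *\<^sub>R proj_line (g z) + (2 * \<rho> z) *\<^sub>R A z)) + - c *\<^sub>R 2 *\<^sub>R mat 1"
  have C\<beta>: "C2_on U ?\<beta> (\<lambda>z. (g z + M *\<^sub>R ((2 * \<rho> z) *\<^sub>R g z)) + - c *\<^sub>R 2 *\<^sub>R (z - y)) ?B"
    by (intro C2_on_add C2_on_cmult C2_on_square C C2_on_norm_square C2_onD(1)[OF C])
  have "continuous_on U (\<lambda>z. M * \<rho> z)" by (intro continuous_intros C2_on_continuous[OF C])
  then obtain d where d: "d > 0" "\<And>z. z \<in> U \<Longrightarrow> dist z y < d \<Longrightarrow> dist (M * \<rho> z) (M * \<rho> y) < 1"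
    using y(1) unfolding continuous_on_iff by (metis zero_less_one)
  obtain s0 where s0: "s0 > 0" "ball y s0 \<subseteq> U" using C2_onD(1)[OF C] y(1) open_contains_ball by blast
  define s where "s = min d s0"
  have s: "s > 0" "ball y s \<subseteq> U" using d s0 by (auto simp: s_def)
  have "?\<beta> z < 0" if z: "z \<in> K \<inter> ball y s" "z \<noteq> y" for z
  proof -
    have "\<bar>M * \<rho> z\<bar> < 1" using d(2)[of z] z s y(2) by (auto simp: s_def dist_commute dist_real_def)
    then have "1 + M * \<rho> z \<ge> 0" by (simp add: abs_less_iff)
    moreover have "\<rho> z \<le> 0" using neg z s by auto
    ultimately have "\<rho> z * (1 + M * \<rho> z) \<le> 0" by (simp add: mult_nonpos_nonneg)
    moreover have "c * (norm (z - y))\<^sup>2 > 0" using c z by simp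
    ultimately show ?thesis by (simp add: algebra_simps power2_eq_square)
  qed
  moreover have "?B y = A y + (2 * M) *\<^sub>R proj_line (g y) - (2 * c) *\<^sub>R mat 1"
    using y(2) by (simp add: mult.commute)
  moreover have "?\<beta> y = 0" using y(2) by simp
  moreover have "C2_on (ball y s) ?\<beta> (\<lambda>z. (g z + M *\<^sub>R ((2 * \<rho> z) *\<^sub>R g z)) + - c *\<^sub>R 2 *\<^sub>R (z - y)) ?B"
    by (rule C2_on_subset[OF C\<beta> open_ball s(2)])
  ultimately show ?thesis using s by blast
qed

text \<open>The negative of \<open>barrier_function\<close> with \<open>c = 1\<close> works once
  \<open>X - 2 M proj_line (g y)\<close> leaves \<open>F\<close>. If it never did for
  \<open>M = n + 1\<close>, division by \<open>2 M\<close> and the limit would put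
  \<open>- proj_line (g y)\<close> into \<open>F\<close>, and rescaling would do so for the unit
  normal.\<close>

lemma upper_barrier_exists:
  assumes F: "cone_subequation F" and neg_proj: "\<And>e. norm e = 1 \<Longrightarrow> - proj_line e \<notin> F"
    and C: "C2_on U \<rho> g A" and y: "y \<in> U" "\<rho> y = 0" "g y \<noteq> 0"
    and neg: "\<And>z. z \<in> K \<Longrightarrow> z \<in> U \<Longrightarrow> \<rho> z \<le> 0"
  shows "\<exists>s>0. \<exists>w g A. C2_on (ball y s) w g A \<and> w y = 0 \<and>
      (\<forall>z\<in>K \<inter> ball y s. z \<noteq> y \<longrightarrow> 0 < w z) \<and> (\<forall>z\<in>ball y s. A z \<notin> F)"
proof -
  have closed: "closed F" using F by (simp add: cone_subequation_def)
  define X where "X = - A y + 2 *\<^sub>R mat 1"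
  have "\<exists>n. X - (2 * real (Suc n)) *\<^sub>R proj_line (g y) \<notin> F"
  proof (rule ccontr)
    assume "\<not> ?thesis"
    then have all: "X - (2 * real (Suc n)) *\<^sub>R proj_line (g y) \<in> F" for n by blast
    have eq: "X - (2 * real (Suc n)) *\<^sub>R proj_line (g y)
      = (2 * real (Suc n)) *\<^sub>R ((inverse (real (Suc n)) * (1 / 2)) *\<^sub>R X - proj_line (g y))" for n
    proof -
      have "2 * real (Suc n) * (inverse (real (Suc n)) * (1 / 2)) = 1"
        by (simp add: field_simps)
      then show ?thesis unfolding scaleR_right_diff_distrib scaleR_scaleR by (simp only: scaleR_one)
    qed
    have "(2 * real (Suc n)) *\<^sub>R ((inverse (real (Suc n)) * (1 / 2)) *\<^sub>R X - proj_line (g y)) \<in> F" for n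
      using all[of n] by (simp only: eq)
    then have in_F: "(inverse (real (Suc n)) * (1 / 2)) *\<^sub>R X - proj_line (g y) \<in> F" for n
      by (rule cone_subequation_scaleR_iff[OF F, THEN iffD1, rotated]) simp
    have "(\<lambda>n. (inverse (real (Suc n)) * (1 / 2)) *\<^sub>R X - proj_line (g y)) \<longlonglongrightarrow> (0 * (1 / 2)) *\<^sub>R X - proj_line (g y)"
      by (intro tendsto_intros LIMSEQ_inverse_real_of_nat)
    then have "- proj_line (g y) \<in> F"
      using closed_sequentially[OF closed, of "\<lambda>n. (inverse (real (Suc n)) * (1 / 2)) *\<^sub>R X - proj_line (g y)"] in_F
      by simp
    moreover have "- proj_line (g y) = (norm (g y))\<^sup>2 *\<^sub>R (- proj_line (sgn (g y)))"
      using proj_line_sgn[OF y(3)] by simp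
    ultimately have "(norm (g y))\<^sup>2 *\<^sub>R (- proj_line (sgn (g y))) \<in> F" by (simp only:)
    then have "- proj_line (sgn (g y)) \<in> F"
      by (rule cone_subequation_scaleR_iff[OF F, THEN iffD1, rotated]) (use y(3) in simp)
    then show False using neg_proj[of "sgn (g y)"] y(3) by (simp add: norm_sgn)
  qed
  then obtain n where n: "X - (2 * real (Suc n)) *\<^sub>R proj_line (g y) \<notin> F" by blast
  obtain s \<beta> g' B where s: "s > 0" and C\<beta>: "C2_on (ball y s) \<beta> g' B" and \<beta>: "\<beta> y = 0"
      "\<forall>z\<in>K \<inter> ball y s. z \<noteq> y \<longrightarrow> \<beta> z < 0"
    and B: "B y = A y + (2 * real (Suc n)) *\<^sub>R proj_line (g y) - (2 * 1) *\<^sub>R mat 1"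
  proof -
    have "\<exists>s>0. \<exists>\<beta> g' B. ball y s \<subseteq> U \<and> C2_on (ball y s) \<beta> g' B \<and> \<beta> y = 0 \<and>
      (\<forall>z\<in>K \<inter> ball y s. z \<noteq> y \<longrightarrow> \<beta> z < 0) \<and>
      B y = A y + (2 * real (Suc n)) *\<^sub>R proj_line (g y) - (2 * 1) *\<^sub>R mat 1"
      by (rule barrier_function[OF C y(1,2) _ zero_less_one]) (rule neg)
    then show ?thesis using that by blast
  qed
  have C': "C2_on (ball y s) (\<lambda>z. - 1 * \<beta> z) (\<lambda>z. - 1 *\<^sub>R g' z) (\<lambda>z. - 1 *\<^sub>R B z)"
    by (rule C2_on_cmult[OF C\<beta>])
  have "- 1 *\<^sub>R B y = X - (2 * real (Suc n)) *\<^sub>R proj_line (g y)" using B by (simp add: X_def)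
  then have "- 1 *\<^sub>R B y \<in> - F" using n by simp
  then obtain s' where s': "s' > 0" "ball y s' \<subseteq> ball y s" "\<And>z. z \<in> ball y s' \<Longrightarrow> - 1 *\<^sub>R B z \<in> - F"
    using C2_on_hess_near[OF C' centre_in_ball[THEN iffD2, OF s] open_Compl[OF closed]] by blast
  have "C2_on (ball y s') (\<lambda>z. - 1 * \<beta> z) (\<lambda>z. - 1 *\<^sub>R g' z) (\<lambda>z. - 1 *\<^sub>R B z)"
    by (rule C2_on_subset[OF C' open_ball s'(2)])
  moreover have "- 1 * \<beta> y = 0" using \<beta> by simp
  moreover have "\<forall>z\<in>K \<inter> ball y s'. z \<noteq> y \<longrightarrow> 0 < - 1 * \<beta> z"
  proof (intro ballI impI)
    fix z assume "z \<in> K \<inter> ball y s'" "z \<noteq> y"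
    then have "\<beta> z < 0" using s'(2) \<beta>(2) by blast
    then show "0 < - 1 * \<beta> z" by simp
  qed
  moreover have "\<forall>z\<in>ball y s'. - 1 *\<^sub>R B z \<notin> F" using s'(3) by blast
  ultimately show ?thesis using s'(1) by blast
qed

text \<open>Strict convexity places the Hessian, corrected by a multiple of the normal projection,
  in the interior of \<open>F\<close>. This leaves room both for the paraboloid that forces strict
  negativity and for moving to nearby points.\<close>

lemma strict_barrier_exists:
  fixes F :: "(real^'n^'n) set"
  assumes C: "C2_on U \<rho> g A" and y: "y \<in> U" "\<rho> y = 0" "g y \<noteq> 0"
    and neg: "\<And>z. z \<in> K \<Longrightarrow> z \<in> U \<Longrightarrow> \<rho> z \<le> 0"
    and convex: "\<exists>T. \<forall>t\<ge>T. A y + t *\<^sub>R proj_line (sgn (g y)) \<in> sym_interior F"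
  shows "\<exists>s>0. \<exists>\<beta> g B. C2_on (ball y s) \<beta> g B \<and> \<beta> y = 0 \<and>
      (\<forall>z\<in>K \<inter> ball y s. z \<noteq> y \<longrightarrow> \<beta> z < 0) \<and> (\<forall>z\<in>ball y s. B z \<in> F)"
proof -
  obtain T where T: "A y + T *\<^sub>R proj_line (sgn (g y)) \<in> sym_interior F"
    using convex by blast
  let ?X = "A y + T *\<^sub>R proj_line (sgn (g y))"
  obtain e where e: "e > 0" "\<And>B. B \<in> sym_mats \<Longrightarrow> dist B ?X < e \<Longrightarrow> B \<in> F"
    using T by (auto simp: sym_interior_def)
  \<comment> \<open>Makes \<open>2 * M\<close> times the rank-one matrix of the unnormalised
    gradient equal to \<open>T\<close> times the unit projection.\<close>
  define M where "M = T / (2 * (norm (g y))\<^sup>2)"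
  define q where "q = norm (mat 1 :: real^'n^'n) + 1"
  \<comment> \<open>Since \<open>q\<close> exceeds the norm of the identity, subtracting
    \<open>2 * c\<close> times the identity costs at most \<open>e / 2\<close>.\<close>
  define c where "c = e / (4 * q)"
  have q: "q > 0" unfolding q_def by (smt (verit) norm_ge_zero)
  have c: "c > 0" using e q by (simp add: c_def)
  obtain s \<beta> g' B where s: "s > 0" and C\<beta>: "C2_on (ball y s) \<beta> g' B" and \<beta>: "\<beta> y = 0"
      "\<forall>z\<in>K \<inter> ball y s. z \<noteq> y \<longrightarrow> \<beta> z < 0"
    and B: "B y = A y + (2 * M) *\<^sub>R proj_line (g y) - (2 * c) *\<^sub>R mat 1"
  proof -
    have "\<exists>s>0. \<exists>\<beta> g' B. ball y s \<subseteq> U \<and> C2_on (ball y s) \<beta> g' B \<and> \<beta> y = 0 \<and>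
      (\<forall>z\<in>K \<inter> ball y s. z \<noteq> y \<longrightarrow> \<beta> z < 0) \<and>
      B y = A y + (2 * M) *\<^sub>R proj_line (g y) - (2 * c) *\<^sub>R mat 1"
      by (rule barrier_function[OF C y(1,2) _ c]) (rule neg)
    then show ?thesis using that by blast
  qed
  have "(2 * M) *\<^sub>R proj_line (g y) = T *\<^sub>R proj_line (sgn (g y))"
    using proj_line_sgn[OF y(3)] y(3) by (simp add: M_def)
  then have BX: "B y = ?X - (2 * c) *\<^sub>R mat 1" using B by simp
  have "dist (B y) ?X = (2 * c) * norm (mat 1 :: real^'n^'n)"
    unfolding BX dist_norm using c by simp
  also have "\<dots> \<le> (2 * c) * q" using c by (intro mult_left_mono) (auto simp: q_def)
  also have "\<dots> = e / 2" using q by (simp add: c_def field_simps)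
  also have "\<dots> < e" using e by simp
  finally have "B y \<in> ball ?X e" by (simp add: dist_commute)
  then obtain s' where s': "s' > 0" "ball y s' \<subseteq> ball y s" "\<And>z. z \<in> ball y s' \<Longrightarrow> B z \<in> ball ?X e"
    using C2_on_hess_near[OF C\<beta> centre_in_ball[THEN iffD2, OF s] open_ball] by blast
  have C': "C2_on (ball y s') \<beta> g' B"
    by (rule C2_on_subset[OF C\<beta> open_ball s'(2)])
  have "B z \<in> F" if "z \<in> ball y s'" for z
    using e(2)[OF C2_on_symmetric[OF C' that]] s'(3)[OF that] by (simp add: dist_commute)
  moreover have "\<forall>z\<in>K \<inter> ball y s'. z \<noteq> y \<longrightarrow> \<beta> z < 0"
    using \<beta>(2) s'(2) by blast
  ultimately show ?thesis using C' \<beta>(1) s'(1) by blast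
qed

text \<open>The smooth local function \<open>b y - \<epsilon> / 2 + k \<beta>\<close> becomes a
  global competitor by gluing onto \<open>a\<close>: for large \<open>k\<close> it falls below the
  lower bound \<open>m\<close> of \<open>a\<close> before the edge of the ball, while its value at
  \<open>y\<close> is fixed.\<close>

lemma lower_barrier_glue:
  assumes F: "cone_subequation F" and G: "bounded G"
    and b: "continuous_on (frontier G) b"
    and a: "a \<in> perron_family F G b" "\<And>z. z \<in> closure G \<Longrightarrow> ereal m \<le> a z"
    and y: "y \<in> frontier G" and s: "s > 0" and C: "C2_on (ball y s) \<beta> g B" and \<beta>y: "\<beta> y = 0"
    and \<beta>: "\<And>z. z \<in> closure G \<Longrightarrow> z \<in> ball y s \<Longrightarrow> z \<noteq> y \<Longrightarrow> \<beta> z < 0"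
    and B: "\<And>z. z \<in> ball y s \<Longrightarrow> B z \<in> F" and \<epsilon>: "\<epsilon> > 0"
  shows "\<exists>u\<in>perron_family F G b. \<exists>d>0. \<forall>z\<in>closure G. dist z y < d \<longrightarrow> ereal (b y - \<epsilon>) \<le> u z"
proof -
  have e2: "\<epsilon> / 2 > 0" using \<epsilon> by simp
  then obtain d0 where d0: "d0 > 0" "\<And>z. z \<in> frontier G \<Longrightarrow> dist z y < d0 \<Longrightarrow> \<bar>b z - b y\<bar> < \<epsilon> / 2"
    using b y unfolding continuous_on_iff dist_real_def by metis
  define d where "d = min d0 (s / 2)"
  have d: "d > 0" "d \<le> d0" "d < s" using d0 s by (auto simp: d_def)
  then have sub: "cball y d \<subseteq> ball y s" by auto
  have cont: "continuous_on (ball y s) \<beta>" by (rule C2_on_continuous[OF C])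
  \<comment> \<open>A full annulus rather than a sphere: the gluing condition concerns all points of
    the ball within \<open>d / 2\<close> of its complement.\<close>
  let ?S = "closure G \<inter> (cball y d - ball y (d / 2))"
  have "compact ?S"
    using G by (intro compact_Int compact_diff) auto
  have "\<exists>\<delta>>0. \<forall>z\<in>?S. \<beta> z \<le> - \<delta>"
  proof (cases "?S = {}")
    case False
    have "continuous_on ?S \<beta>" by (rule continuous_on_subset[OF cont]) (use sub in auto)
    then obtain p where p: "p \<in> ?S" "\<forall>z\<in>?S. \<beta> z \<le> \<beta> p"
      using continuous_attains_sup[OF \<open>compact ?S\<close> False] by blast
    moreover have "p \<noteq> y" using p(1) d(1) by auto
    then have "\<beta> p < 0" using \<beta>[of p] p(1) sub by auto
    ultimately show ?thesis by (intro exI[of _ "- \<beta> p"]) auto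
  qed (auto intro: exI[of _ 1])
  then obtain \<delta> where \<delta>: "\<delta> > 0" "\<And>z. z \<in> ?S \<Longrightarrow> \<beta> z \<le> - \<delta>" by blast
  \<comment> \<open>With \<open>\<beta> \<le> - \<delta>\<close> on the annulus, this factor pushes
    the barrier below \<open>m\<close> there.\<close>
  define k where "k = (\<bar>m - b y\<bar> + 1) / \<delta>"
  have k: "k > 0" "k * \<delta> = \<bar>m - b y\<bar> + 1" using \<delta>(1) by (auto simp: k_def)
  have sub': "ball y d \<subseteq> ball y s" using d by auto
  let ?c = "\<lambda>z. (b y - \<epsilon> / 2) + k * \<beta> z"
  have Cc: "C2_on (ball y d) ?c (\<lambda>z. 0 + k *\<^sub>R g z) (\<lambda>z. 0 + k *\<^sub>R B z)"
    by (intro C2_on_add C2_on_const C2_on_cmult C2_on_subset[OF C _ sub'] open_ball)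
  have sh: "subharmonic F (ball y d) (\<lambda>z. ereal (?c z))"
    by (rule C2_on_subharmonic[OF F Cc])
      (use B sub' cone_subequation_scaleR_iff[OF F k(1)] in auto)
  let ?u = "\<lambda>z. if z \<in> ball y d then max (a z) (ereal (?c z)) else a z"
  have u: "?u \<in> perron_family F G b"
  proof (rule perron_family_glue[OF a(1) open_ball])
    show "usc_on (closure G \<inter> ball y d) (\<lambda>z. ereal (?c z))"
      using C2_on_continuous[OF Cc]
      by (intro usc_on_continuous continuous_on_ereal) (rule continuous_on_subset, auto)
    show "subharmonic F (G \<inter> ball y d) (\<lambda>z. ereal (?c z))" using sh by (rule subharmonic_subset) auto
    show "ereal (?c z) \<le> ereal (b z)" if z: "z \<in> frontier G \<inter> ball y d" for z
    proof -
      have "\<beta> z \<le> 0" using \<beta>[of z] \<beta>y z sub' by (cases "z = y") (auto simp: frontier_def)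
      then have "k * \<beta> z \<le> 0" using k(1) by (simp add: mult_nonneg_nonpos)
      moreover have "\<bar>b z - b y\<bar> < \<epsilon> / 2" using d0(2)[of z] z d by (auto simp: dist_commute)
      ultimately have "?c z \<le> b z" by linarith
      then show ?thesis by simp
    qed
    show "\<exists>e>0. \<forall>x\<in>closure G \<inter> ball y d. dist x z < e \<longrightarrow> ereal (?c x) \<le> a x"
      if z: "z \<in> closure G" "z \<notin> ball y d" for z
    proof (intro exI conjI ballI impI)
      show "d / 2 > 0" using d by simp
      fix x assume x: "x \<in> closure G \<inter> ball y d" "dist x z < d / 2"
      have "dist y z \<le> dist y x + dist x z" by (rule dist_triangle)
      then have "x \<in> ?S" using x z(2) by auto
      then have "k * \<beta> x \<le> k * (- \<delta>)" using \<delta>(2) k(1) by (intro mult_left_mono) auto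
      then have "?c x \<le> m" using k(2) e2 by (simp add: abs_if split: if_splits)
      then show "ereal (?c x) \<le> a x" using a(2)[of x] x(1) by (meson IntD1 ereal_less_eq(3) order_trans)
    qed
  qed auto
  have "\<epsilon> / 2 / k > 0" using e2 k by simp
  moreover have "y \<in> ball y s" using s by simp
  ultimately obtain d1 where d1: "d1 > 0" "\<And>z. z \<in> ball y s \<Longrightarrow> dist z y < d1 \<Longrightarrow> \<bar>\<beta> z - \<beta> y\<bar> < \<epsilon> / 2 / k"
    using cont unfolding continuous_on_iff dist_real_def by metis
  have "ereal (b y - \<epsilon>) \<le> ?u z" if z: "z \<in> closure G" "dist z y < min d d1" for z
  proof -
    have "\<bar>\<beta> z\<bar> < \<epsilon> / 2 / k" using d1(2)[of z] z d \<beta>y by (auto simp: dist_commute)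
    then have "\<bar>\<beta> z\<bar> * k < \<epsilon> / 2" using k(1) by (simp add: pos_less_divide_eq)
    moreover have "- (\<bar>\<beta> z\<bar> * k) \<le> k * \<beta> z"
      using k(1) by (metis abs_le_D2 abs_mult abs_of_pos minus_le_iff mult.commute order_refl)
    ultimately have "b y - \<epsilon> \<le> ?c z" by linarith
    then have "ereal (b y - \<epsilon>) \<le> max (a z) (ereal (?c z))" by (simp add: le_max_iff_disj)
    then show ?thesis using z by (simp add: dist_commute)
  qed
  then show ?thesis using d d1 by (intro bexI[OF _ u] exI[of _ "min d d1"]) auto
qed

lemma local_defining_function_closure:
  assumes \<Omega>: "open \<Omega>" and L: "local_defining_function \<Omega> y U \<rho>"
  shows "C2_on U \<rho> (grad \<rho>) (hess \<rho>)" "z \<in> closure \<Omega> \<Longrightarrow> z \<in> U \<Longrightarrow> \<rho> z \<le> 0"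
    "y \<in> frontier \<Omega> \<Longrightarrow> \<rho> y = 0"
proof -
  have L': "open U" "y \<in> U" "smooth_on U \<rho>" "\<Omega> \<inter> U = {z \<in> U. \<rho> z < 0}"
    using L by (auto simp: local_defining_function_def)
  show C: "C2_on U \<rho> (grad \<rho>) (hess \<rho>)"
    using L' by (intro C2_on_if_Ck_on) (auto simp: smooth_on_def)
  show le: "\<rho> z \<le> 0" if z: "z \<in> closure \<Omega>" "z \<in> U" for z
  proof (rule ccontr)
    assume pos: "\<not> \<rho> z \<le> 0"
    have "open (U \<inter> \<rho> -` {0<..})"
      using C2_on_continuous[OF C] L'(1) by (intro continuous_open_preimage) auto
    moreover have "(U \<inter> \<rho> -` {0<..}) \<inter> \<Omega> = {}" using L'(4) by force
    ultimately have "(U \<inter> \<rho> -` {0<..}) \<inter> closure \<Omega> = {}" using open_Int_closure_eq_empty by blast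
    then show False using z pos by auto
  qed
  show "\<rho> y = 0" if y: "y \<in> frontier \<Omega>"
  proof -
    have "y \<notin> \<Omega>" "y \<in> closure \<Omega>" using y \<Omega> by (auto simp: frontier_def interior_open)
    then show ?thesis using le[of y] L'(2,4) by force
  qed
qed

section \<open>Application to the domain with closed balls removed\<close>

theorem theorem6p1:
  fixes F :: "(real^'n^'n) set"
    and \<Omega> :: "(real^'n) set"
    and k :: nat and x :: "nat \<Rightarrow> real^'n"
    and r0 r :: real
    and \<phi> :: "real^'n \<Rightarrow> real"
    and \<psi> :: "real^'n \<Rightarrow> ereal"
  assumes F: "cone_subequation F"
    and negP: "\<forall>e. norm e = 1 \<longrightarrow> - proj_line e \<notin> F"
    and dom: "open \<Omega>" "connected \<Omega>" "bounded \<Omega>" "\<Omega> \<noteq> {}"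
    and bdry: "smooth_strictly_convex_boundary F \<Omega>"
    and xs: "\<forall>j<k. x j \<in> \<Omega>" "\<forall>i<k. \<forall>j<k. i \<noteq> j \<longrightarrow> x i \<noteq> x j"
    and r0: "r0 > 0" "\<forall>j<k. cball (x j) r0 \<subseteq> \<Omega>"
      "\<forall>i<k. \<forall>j<k. i \<noteq> j \<longrightarrow> cball (x i) r0 \<inter> cball (x j) r0 = {}"
    and r: "0 < r" "r \<le> r0"
    and \<phi>: "continuous_on (frontier \<Omega>) \<phi>"
    and \<psi>_sub: "subharmonic F \<Omega> \<psi>"
    and \<psi>_bd: "\<forall>z\<in>frontier \<Omega>. \<psi> z \<le> ereal (\<phi> z)"
    and \<psi>_cases:
      "(continuous_on (closure \<Omega>) \<psi> \<and> (\<forall>z\<in>closure \<Omega>. \<psi> z \<noteq> \<infinity>) \<and>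
          (\<forall>z\<in>closure \<Omega>. \<psi> z = - \<infinity> \<longleftrightarrow> (\<exists>j<k. z = x j)))
       \<or>
       (continuous_on (closure \<Omega>) \<psi> \<and> (\<forall>z\<in>closure \<Omega>. \<psi> z \<noteq> \<infinity> \<and> \<psi> z \<noteq> - \<infinity>) \<and>
          (\<forall>j<k. (\<exists>e>0. \<forall>z\<in>ball (x j) e. z \<noteq> x j \<longrightarrow> \<psi> (x j) < \<psi> z) \<and>
                 \<not> (\<exists>S \<phi>'. test_function \<psi> (x j) S \<phi>')))"
  defines "H \<equiv> (\<lambda>z. Sup {u z | u. u \<in> {u. usc_on (closure (\<Omega> - (\<Union>j\<in>{..<k}. cball (x j) r))) u \<and> (\<forall>z\<in>closure (\<Omega> - (\<Union>j\<in>{..<k}. cball (x j) r)). u z \<noteq> \<infinity>) \<and>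
                  subharmonic F (\<Omega> - (\<Union>j\<in>{..<k}. cball (x j) r)) u \<and>
                  (\<forall>z\<in>frontier (\<Union>j\<in>{..<k}. cball (x j) r). u z \<le> \<psi> z) \<and> (\<forall>z\<in>frontier \<Omega>. u z \<le> ereal (\<phi> z))}})"
  shows "(\<forall>z\<in>closure (\<Omega> - (\<Union>j\<in>{..<k}. cball (x j) r)). H z \<noteq> \<infinity> \<and> H z \<noteq> - \<infinity>) \<and> continuous_on (closure (\<Omega> - (\<Union>j\<in>{..<k}. cball (x j) r))) H \<and>
         harmonic F (\<Omega> - (\<Union>j\<in>{..<k}. cball (x j) r)) H \<and>
         (\<forall>z\<in>frontier (\<Union>j\<in>{..<k}. cball (x j) r). H z = \<psi> z) \<and> (\<forall>z\<in>frontier \<Omega>. H z = ereal (\<phi> z))"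
proof -
  define D where "D = (\<Union>j\<in>{..<k}. cball (x j) r)"
  define G where "G = \<Omega> - D"
  have D\<Omega>: "D \<subseteq> \<Omega>" using r0(2) r by (fastforce simp: D_def)
  have closedD: "closed D" unfolding D_def by (intro closed_UN) auto
  have fD: "frontier D \<subseteq> D" using closedD by (rule frontier_subset_closed)
  have openG: "open G" unfolding G_def by (intro open_Diff dom closedD)
  have boundedG: "bounded G" using dom(3) by (rule bounded_subset) (auto simp: G_def)
  have cG: "closure G \<subseteq> closure \<Omega>" by (intro closure_mono) (auto simp: G_def)
  have fr_disj: "z \<notin> \<Omega>" if "z \<in> frontier \<Omega>" for z
    using that dom(1) by (simp add: frontier_def interior_open)
  have frG: "frontier G = frontier \<Omega> \<union> frontier D"
  proof (intro equalityI subsetI)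
    fix z assume "z \<in> frontier G"
    then have z: "z \<in> closure G" "z \<notin> G" using openG by (auto simp: frontier_def interior_open)
    show "z \<in> frontier \<Omega> \<union> frontier D"
    proof (cases "z \<in> \<Omega>")
      case True
      have "closure G \<subseteq> closure (- D)" by (intro closure_mono) (auto simp: G_def)
      then show ?thesis using z True closure_subset[of D] by (auto simp: G_def frontier_closures)
    next
      case False
      then show ?thesis using z(1) cG dom(1) by (auto simp: frontier_def interior_open)
    qed
  next
    fix z assume z: "z \<in> frontier \<Omega> \<union> frontier D"
    have "z \<notin> G" using z fr_disj fD by (auto simp: G_def)
    moreover have "z \<in> closure G"
    proof (cases "z \<in> frontier D")
      case True
      then have "z \<in> \<Omega> \<inter> closure (- D)" using fD D\<Omega> by (auto simp: frontier_closures)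
      then have "z \<in> closure (\<Omega> \<inter> - D)" using open_Int_closure_subset[OF dom(1)] by blast
      then show ?thesis by (simp add: G_def Diff_eq)
    next
      case False
      then have "z \<in> - D \<inter> closure \<Omega>" using z fr_disj D\<Omega> by (auto simp: frontier_def)
      then have "z \<in> closure (- D \<inter> \<Omega>)" using open_Int_closure_subset[OF open_Compl[OF closedD]] by blast
      then show ?thesis by (simp add: G_def Diff_eq Int_commute)
    qed
    ultimately show "z \<in> frontier G" using openG by (simp add: frontier_def interior_open)
  qed
  \<comment> \<open>Keeps the centres out of \<open>closure G\<close>, so psi is finite there in the
    polar case, and later puts each point of \<open>frontier D\<close> exactly on a sphere of radius
    \<open>r\<close>.\<close>
  have away: "r \<le> dist (x j) z" if "j < k" "z \<in> closure G" for j z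
  proof -
    have "ball (x j) r \<inter> G = {}" using that(1) ball_subset_cball[of "x j" r] by (auto simp: G_def D_def)
    then have "ball (x j) r \<inter> closure G = {}" using open_Int_closure_eq_empty[OF open_ball] by blast
    then show ?thesis using that(2) by force
  qed
  have fin: "\<bar>\<psi> z\<bar> \<noteq> \<infinity>" if z: "z \<in> closure G" for z
  proof -
    have "\<nexists>j. j < k \<and> z = x j" using away[OF _ z] r(1) by fastforce
    then show ?thesis using \<psi>_cases z cG by auto
  qed
  have \<psi>_cont: "continuous_on (closure G) \<psi>"
    using \<psi>_cases by (intro continuous_on_subset[OF _ cG]) blast
  define p where "p = (\<lambda>z. real_of_ereal (\<psi> z))"
  have \<psi>p: "\<psi> z = ereal (p z)" if "z \<in> closure G" for z
    using fin[OF that] by (simp add: p_def ereal_real)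
  have p_cont: "continuous_on (closure G) p"
    using continuous_on_iff_real[of "closure G" \<psi>] fin \<psi>_cont by (simp add: p_def o_def)
  \<comment> \<open>The two boundary pieces are disjoint closed sets, so the case distinction is
    continuous and the prescribed family becomes \<open>perron_family F G b\<close>.\<close>
  define b where "b = (\<lambda>z. if z \<in> frontier \<Omega> then \<phi> z else p z)"
  have fr_cl: "frontier G \<subseteq> closure G" by (simp add: frontier_def)
  have b_\<Omega>: "b z = \<phi> z" if "z \<in> frontier \<Omega>" for z using that by (simp add: b_def)
  have b_D: "ereal (b z) = \<psi> z" if "z \<in> frontier D" for z
  proof -
    have "z \<notin> frontier \<Omega>" using fr_disj that fD D\<Omega> by blast
    then show ?thesis using \<psi>p[of z] that fr_cl frG by (auto simp: b_def)
  qed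
  have b_cont: "continuous_on (frontier G) b"
    unfolding frG b_def
  proof (rule continuous_on_cases)
    show "continuous_on (frontier D) p"
      by (rule continuous_on_subset[OF p_cont]) (use frG fr_cl in auto)
    show "\<forall>z. z \<in> frontier \<Omega> \<and> z \<notin> frontier \<Omega> \<or> z \<in> frontier D \<and> z \<in> frontier \<Omega> \<longrightarrow> \<phi> z = p z"
      using fr_disj fD D\<Omega> by blast
  qed (use \<phi> in auto)
  have family: "perron_family F G b = {u. usc_on (closure G) u \<and> (\<forall>z\<in>closure G. u z \<noteq> \<infinity>) \<and>
      subharmonic F G u \<and> (\<forall>z\<in>frontier D. u z \<le> \<psi> z) \<and> (\<forall>z\<in>frontier \<Omega>. u z \<le> ereal (\<phi> z))}"
    unfolding perron_family_def frG using b_\<Omega> b_D by (auto simp: ball_Un)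
  have "subharmonic F G \<psi>" by (rule subharmonic_subset[OF \<psi>_sub]) (auto simp: G_def)
  moreover have "\<psi> z \<noteq> \<infinity>" if "z \<in> closure G" for z using fin[OF that] by auto
  ultimately have \<psi>_family: "\<psi> \<in> perron_family F G b"
    unfolding family using usc_on_continuous[OF \<psi>_cont] \<psi>_bd by auto
  have "continuous_on (closure G) (\<lambda>z. - p z)" by (intro continuous_intros p_cont)
  then obtain m' where "\<And>z. z \<in> closure G \<Longrightarrow> - p z \<le> m'"
    using compact_continuous_bound[of "closure G"] boundedG by auto
  then have m: "ereal (- m') \<le> \<psi> z" if "z \<in> closure G" for z
    using \<psi>p[OF that] that by fastforce
  have defining: "\<exists>U \<rho>. local_defining_function \<Omega> y U \<rho> \<and> grad \<rho> y \<noteq> 0 \<and> y \<in> U \<and>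
      (\<exists>T. \<forall>t\<ge>T. hess \<rho> y + t *\<^sub>R proj_line (sgn (grad \<rho> y)) \<in> sym_interior F)"
    if "y \<in> frontier \<Omega>" for y
  proof -
    note bd = bspec[OF bdry[unfolded smooth_strictly_convex_boundary_def] that]
    obtain U \<rho> where L: "local_defining_function \<Omega> y U \<rho>" using conjunct1[OF bd] by blast
    have "grad \<rho> y \<noteq> 0" "y \<in> U" using L by (auto simp: local_defining_function_def)
    with L conjunct2[OF bd, rule_format, OF L] show ?thesis
      by (intro exI[of _ U] exI[of _ \<rho>] conjI)
  qed
  interpret P: perron_dirichlet F G b
  proof
    show "\<exists>s>0. \<exists>w g A. C2_on (ball y s) w g A \<and> w y = 0 \<and>
      (\<forall>z\<in>closure G \<inter> ball y s. z \<noteq> y \<longrightarrow> 0 < w z) \<and> (\<forall>z\<in>ball y s. A z \<notin> F)"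
      if y: "y \<in> frontier G" for y
    proof (cases "y \<in> frontier \<Omega>")
      case True
      from defining[OF this] obtain U \<rho> where L: "local_defining_function \<Omega> y U \<rho>" "grad \<rho> y \<noteq> 0" "y \<in> U"
        by blast
      note L' = local_defining_function_closure[OF dom(1) L(1)]
      show ?thesis
        by (rule upper_barrier_exists[OF F _ L'(1) L(3) L'(3)[OF True] L(2)]) (use negP L'(2) cG in auto)
    next
      case False
      then have "y \<in> frontier D" using y frG by blast
      then obtain j where j: "j < k" "dist (x j) y \<le> r" using fD by (auto simp: D_def)
      then have yr: "dist (x j) y = r" using away[OF j(1), of y] y fr_cl by force
      \<comment> \<open>The function \<open>r^2 - |z - x_j|^2\<close> is nonpositive on
        \<open>closure G\<close> and has nonzero gradient on the sphere, which is all that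
        \<open>upper_barrier_exists\<close> asks of a defining function.\<close>
      have C: "C2_on UNIV (\<lambda>z. r\<^sup>2 + - 1 * (norm (z - x j))\<^sup>2) (\<lambda>z. 0 + - 1 *\<^sub>R 2 *\<^sub>R (z - x j))
          (\<lambda>z. 0 + - 1 *\<^sub>R 2 *\<^sub>R mat 1)"
        by (intro C2_on_add C2_on_const C2_on_cmult C2_on_norm_square open_UNIV)
      show ?thesis
      proof (rule upper_barrier_exists[OF F _ C UNIV_I])
        show "r\<^sup>2 + - 1 * (norm (y - x j))\<^sup>2 = 0" using yr by (simp add: dist_norm norm_minus_commute)
        show "0 + - 1 *\<^sub>R 2 *\<^sub>R (y - x j) \<noteq> 0" using yr r(1) by auto
        show "r\<^sup>2 + - 1 * (norm (z - x j))\<^sup>2 \<le> 0" if "z \<in> closure G" for z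
        proof -
          have "r \<le> norm (z - x j)" using away[OF j(1) that] by (simp add: dist_norm norm_minus_commute)
          then have "r\<^sup>2 \<le> (norm (z - x j))\<^sup>2" using r(1) by (intro power_mono) auto
          then show ?thesis by simp
        qed
      qed (use negP in auto)
    qed
    show "\<exists>u\<in>perron_family F G b. \<exists>d>0. \<forall>z\<in>closure G. dist z y < d \<longrightarrow> ereal (b y - \<epsilon>) \<le> u z"
      if y: "y \<in> frontier G" and \<epsilon>: "\<epsilon> > 0" for y \<epsilon>
    proof (cases "y \<in> frontier \<Omega>")
      case True
      from defining[OF this] obtain U \<rho> where L: "local_defining_function \<Omega> y U \<rho>" "grad \<rho> y \<noteq> 0" "y \<in> U"
        "\<exists>T. \<forall>t\<ge>T. hess \<rho> y + t *\<^sub>R proj_line (sgn (grad \<rho> y)) \<in> sym_interior F"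
        by blast
      note L' = local_defining_function_closure[OF dom(1) L(1)]
      have "\<exists>s>0. \<exists>\<beta> g B. C2_on (ball y s) \<beta> g B \<and> \<beta> y = 0 \<and>
          (\<forall>z\<in>closure G \<inter> ball y s. z \<noteq> y \<longrightarrow> \<beta> z < 0) \<and> (\<forall>z\<in>ball y s. B z \<in> F)"
        by (rule strict_barrier_exists[OF L'(1) L(3) L'(3)[OF True] L(2) _ L(4)]) (use L'(2) cG in auto)
      then obtain s \<beta> g B where s: "s > 0" "C2_on (ball y s) \<beta> g B" "\<beta> y = 0"
          "\<forall>z\<in>closure G \<inter> ball y s. z \<noteq> y \<longrightarrow> \<beta> z < 0" "\<forall>z\<in>ball y s. B z \<in> F" by blast
      show ?thesis
        by (rule lower_barrier_glue[OF F boundedG b_cont \<psi>_family m y s(1,2,3)]) (use s(4,5) \<epsilon> in auto)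
    next
      case False
      \<comment> \<open>On the spheres the boundary datum is psi itself, so continuity of this
        competitor is already the lower barrier estimate.\<close>
      then have by_eq: "b y = p y" by (simp add: b_def)
      obtain d where d: "d > 0" "\<And>z. z \<in> closure G \<Longrightarrow> dist z y < d \<Longrightarrow> \<bar>p z - p y\<bar> < \<epsilon>"
        using p_cont y fr_cl \<epsilon> unfolding continuous_on_iff dist_real_def by (metis subsetD)
      have "ereal (b y - \<epsilon>) \<le> \<psi> z" if "z \<in> closure G" "dist z y < d" for z
        using d(2)[OF that] \<psi>p[OF that(1)] by_eq by auto
      then show ?thesis using d(1) by (intro bexI[OF _ \<psi>_family]) blast
    qed
    show "\<exists>u\<in>perron_family F G b. \<forall>z\<in>closure G. u z \<noteq> - \<infinity>"
      by (rule bexI[OF _ \<psi>_family]) (simp add: \<psi>p)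
  qed (use F negP openG boundedG b_cont in auto)
  have "H z = P.H z" for z
  proof -
    have "P.H z = (SUP u\<in>perron_family F G b. u z)" by (rule P.H_def)
    then show ?thesis unfolding H_def family unfolding G_def D_def by (simp only: Setcompr_eq_image)
  qed
  then have HP: "H = P.H" by blast
  have "H z = \<psi> z" if "z \<in> frontier D" for z
    using P.perron_solution(4) that b_D frG by (auto simp: HP)
  moreover have "H z = ereal (\<phi> z)" if "z \<in> frontier \<Omega>" for z
    using P.perron_solution(4) that b_\<Omega> frG by (auto simp: HP)
  ultimately show ?thesis
    using P.perron_solution(1-3) unfolding HP G_def D_def by blast
qed

end
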